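(* Let $K\ge 2$ and consider the $K$-user MIMO interference channel $[\prod_{k=1}^K (N_k,M_k)]$ with single-stream transmission. Single-stream interference alignment (IA) is feasible in this channel if and only if $$\mathcal{N}_{\mathrm{Var}}(\mathcal{S}_{\mathrm{RX}},\mathcal{S}_{\mathrm{TX}})\ \ge\ \mathcal{N}_{\mathrm{Eq}}(\mathcal{S}_{\mathrm{RX}},\mathcal{S}_{\mathrm{TX}})\qquad\text{for all } \mathcal{S}_{\mathrm{RX}},\mathcal{S}_{\mathrm{TX}}\subseteq\mathcal{K}=\{1,\dots,K\}.$$
   Context: Setting: $K$ transmitter/receiver pairs; transmitter (TX) $j$ has $M_j\ge 1$ antennas, receiver (RX) $i$ has $N_i\ge1$ antennas, and TX $j$ sends one data stream to RX $j$. The channel from TX $j$ to RX $i$ is a matrix $\mathbf H_{ij}\in\mathbb C^{N_i\times M_j}$, and all entries of all $\mathbf H_{ij}$ are i.i.d. according to a continuous probability distribution. Single-stream IA is called feasible if, with probability one over the channel, there exist nonzero vectors $\mathbf t_j\in\mathbb C^{M_j}$ and $\mathbf g_i\in\mathbb C^{N_i}$ ($i,j\in\mathcal K$) such that $\mathbf g_i^{H}\mathbf H_{ij}\mathbf t_j=0$ for all $i\neq j$. For subsets $\mathcal S_{\mathrm{RX}},\mathcal S_{\mathrm{TX}}\subseteq\mathcal K$ define $\mathcal N_{\mathrm{Var}}(\mathcal S_{\mathrm{RX}},\mathcal S_{\mathrm{TX}})=\sum_{i\in\mathcal S_{\mathrm{RX}}}(N_i-1)+\sum_{i\in\mathcal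 S_{\mathrm{TX}}}(M_i-1)$ and $\mathcal N_{\mathrm{Eq}}(\mathcal S_{\mathrm{RX}},\mathcal S_{\mathrm{TX}})=\#\{(j,k): j\in\mathcal S_{\mathrm{RX}},\,k\in\mathcal S_{\mathrm{TX}},\,j\neq k\}$. *)

theory Defs
  imports "HOL-Probability.Probability"
begin

text \<open>Users are indexed by {1..K}. A channel realisation is a function
  H (i, j, a, b) giving entry (a, b) of the matrix H_ij (from TX j to RX i),
  a < N i, b < M j. Vectors of length n are functions nat => complex, indices < n.\<close>

definition channel_entries :: "nat \<Rightarrow> (nat \<Rightarrow> nat) \<Rightarrow> (nat \<Rightarrow> nat) \<Rightarrow> (nat \<times> nat \<times> nat \<times> nat) set" where
  "channel_entries K N M = {(i, j, a, b). i \<in> {1..K} \<and> j \<in> {1..K} \<and> a < N i \<and> b < M j}"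

definition IA_solvable ::
  "nat \<Rightarrow> (nat \<Rightarrow> nat) \<Rightarrow> (nat \<Rightarrow> nat) \<Rightarrow> (nat \<times> nat \<times> nat \<times> nat \<Rightarrow> complex) \<Rightarrow> bool" where
  "IA_solvable K N M H \<longleftrightarrow>
     (\<exists>(t :: nat \<Rightarrow> nat \<Rightarrow> complex) (g :: nat \<Rightarrow> nat \<Rightarrow> complex).
        (\<forall>j\<in>{1..K}. \<exists>b<M j. t j b \<noteq> 0) \<and>
        (\<forall>i\<in>{1..K}. \<exists>a<N i. g i a \<noteq> 0) \<and>
        (\<forall>i\<in>{1..K}. \<forall>j\<in>{1..K}. i \<noteq> j \<longrightarrow>
           (\<Sum>a<N i. \<Sum>b<M j. cnj (g i a) * H (i, j, a, b) * t j b) = 0))"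

definition IA_feasible ::
  "complex measure \<Rightarrow> nat \<Rightarrow> (nat \<Rightarrow> nat) \<Rightarrow> (nat \<Rightarrow> nat) \<Rightarrow> bool" where
  "IA_feasible \<mu> K N M \<longleftrightarrow>
     (AE H in PiM (channel_entries K N M) (\<lambda>_. \<mu>). IA_solvable K N M H)"

definition N_Var :: "(nat \<Rightarrow> nat) \<Rightarrow> (nat \<Rightarrow> nat) \<Rightarrow> nat set \<Rightarrow> nat set \<Rightarrow> nat" where
  "N_Var N M SR ST = (\<Sum>i\<in>SR. N i - 1) + (\<Sum>i\<in>ST. M i - 1)"

definition N_Eq :: "nat set \<Rightarrow> nat set \<Rightarrow> nat" where
  "N_Eq SR ST = card {(j, k). j \<in> SR \<and> k \<in> ST \<and> j \<noteq> k}"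

end

theory Submission
  imports Defs "HOL-Library.Function_Algebras" "HOL-Computational_Algebra.Fundamental_Theorem_Algebra"
begin

text \<open>By Hall's theorem the counting condition holds iff the equations, one for each link \<open>(i, j)\<close> with
  \<open>i \<noteq> j\<close>, can be matched injectively with affine variables occurring in them.

  If there is such a matching, then every channel \<open>H\<close> is solvable. Choose \<open>H0\<close> such that the equation of
  each link is its matched variable. For small \<open>s\<close> the channel \<open>H0 + s H\<close> has a solution by a contraction
  argument. If \<open>H\<close> had none, the Nullstellensatz would write all monomials of some large
  multidegree as combinations of the forms of \<open>H\<close>; substituting the forms of \<open>H0\<close> gives a matrix
  having \<open>- s\<close> as an eigenvalue for every small \<open>s\<close>, which is impossible.

  If the condition fails for \<open>(SR, ST)\<close>, the solvable channels lie in finitely many images of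
  polynomial maps from spaces of dimension less than the number of channel entries. Counting monomials
  shows that each image lies in a hypersurface, and hypersurfaces are null sets for products of atomless
  measures.\<close>

section \<open>Linear algebra and matchings\<close>

text \<open>The obstacle in passing from the count to solvability is that a matching yields one
  special channel \<open>H0\<close>, and perturbing it reaches only channels near \<open>H0\<close>,
  while an arbitrary \<open>H\<close> is wanted. What helps is that solutions are points of a
  product of projective spaces, one for each transmit or receive vector, so zeros cannot escape to
  infinity. On the line \<open>H0 + s H\<close> the channel \<open>H\<close> itself sits at infinite
  s. If \<open>H\<close> had no solution there, then only finitely many points of the line could
  have one; hence solvability for infinitely many s settles \<open>H\<close>, however small these s
  are. This properness statement replaces dimension theory of projective varieties.

  The converse needs only a dimension bound for images of polynomial maps. Such maps appear after
  normalising one nonzero entry of each vector to 1, and there are finitely many ways to choose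
  these entries.\<close>

lemma linear_dependence:
  fixes e :: "'s \<Rightarrow> 'x \<Rightarrow> 'a::field"
  assumes "finite X" "finite S" "card X < card S"
  shows "\<exists>a. (\<exists>s\<in>S. a s \<noteq> 0) \<and> (\<forall>x\<in>X. (\<Sum>s\<in>S. a s * e s x) = 0)"
  using assms
proof (induction X arbitrary: S e rule: finite_induct)
  case empty
  then obtain s where "s \<in> S" by fastforce
  then show ?case by (intro exI[of _ "\<lambda>_. 1"]) auto
next
  case (insert x X)
  show ?case
  proof (cases "\<forall>s\<in>S. e s x = 0")
    case True
    have "card X < card S" using insert.prems insert.hyps by simp
    from insert.IH[OF insert.prems(1) this, of e] True show ?thesis by auto
  next
    case False
    then obtain s0 where s0: "s0 \<in> S" "e s0 x \<noteq> 0" by blast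
    define S' where "S' = S - {s0}"
    define e' where "e' = (\<lambda>s y. e s y - e s x / e s0 x * e s0 y)"
    have S: "S = insert s0 S'" "s0 \<notin> S'" "finite S'"
      using s0 insert.prems by (auto simp: S'_def)
    have "card X < card S'"
      using insert.prems insert.hyps s0 by (simp add: S'_def)
    from insert.IH[OF \<open>finite S'\<close> this, of e'] obtain a
      where a: "\<exists>s\<in>S'. a s \<noteq> 0" "\<forall>y\<in>X. (\<Sum>s\<in>S'. a s * e' s y) = 0" by blast
    \<comment> \<open>The coefficient of the pivot \<open>s0\<close> is determined last, so as to
      cancel coordinate \<open>x\<close>; in every coordinate it turns the combination of the
      \<open>e s\<close> into that of the reduced vectors \<open>e' s\<close>.\<close>
    define b where "b = - (\<Sum>s\<in>S'. a s * e s x) / e s0 x"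
    have eq: "(\<Sum>s\<in>S. (a(s0 := b)) s * e s y) = b * e s0 y + (\<Sum>s\<in>S'. a s * e s y)" for y
      using S by (auto intro!: sum.cong)
    have "(\<Sum>s\<in>S. (a(s0 := b)) s * e s y) = (\<Sum>s\<in>S'. a s * e' s y)" for y
    proof -
      have "b * e s0 y = - (\<Sum>s\<in>S'. a s * (e s x / e s0 x * e s0 y))"
        unfolding b_def
        by (simp add: sum_distrib_left sum_distrib_right sum_divide_distrib algebra_simps)
      then show ?thesis
        unfolding eq e'_def right_diff_distrib sum_subtractf by simp
    qed
    moreover have "(\<Sum>s\<in>S. (a(s0 := b)) s * e s x) = 0"
      unfolding eq using s0 by (simp add: b_def)
    ultimately have "\<forall>y\<in>insert x X. (\<Sum>s\<in>S. (a(s0 := b)) s * e s y) = 0"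
      using a(2) by (metis insert_iff)
    moreover have "\<exists>s\<in>S. (a(s0 := b)) s \<noteq> 0"
      using a(1) S(1,2) by (metis fun_upd_other insertCI)
    ultimately show ?thesis by blast
  qed
qed

text \<open>Applying the matrix and subtracting \<open>s0\<close> times the relation removes the
  vector of \<open>s0\<close> and multiplies every other coefficient by \<open>s - s0\<close>.
  Indexing the vectors by their eigenvalues makes these factors nonzero.\<close>

lemma eigenvectors_independent:
  fixes e :: "'a::field \<Rightarrow> 'x \<Rightarrow> 'a"
  assumes "finite X" "finite S"
    and eig: "\<And>s x. s \<in> S \<Longrightarrow> x \<in> X \<Longrightarrow> (\<Sum>y\<in>X. b x y * e s y) = s * e s x"
    and nz: "\<And>s. s \<in> S \<Longrightarrow> \<exists>x\<in>X. e s x \<noteq> 0"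
    and dep: "\<forall>x\<in>X. (\<Sum>s\<in>S. a s * e s x) = 0"
  shows "\<forall>s\<in>S. a s = 0"
  using assms(2-)
proof (induction S arbitrary: a rule: finite_induct)
  case (insert s0 S)
  have "(\<Sum>s\<in>S. a s * (s - s0) * e s x) = 0" if x: "x \<in> X" for x
  proof -
    have "0 = (\<Sum>y\<in>X. b x y * (\<Sum>s\<in>insert s0 S. a s * e s y))"
      using insert.prems(3) by simp
    also have "\<dots> = (\<Sum>y\<in>X. \<Sum>s\<in>insert s0 S. b x y * (a s * e s y))"
      by (simp only: sum_distrib_left)
    also have "\<dots> = (\<Sum>s\<in>insert s0 S. \<Sum>y\<in>X. b x y * (a s * e s y))"
      by (rule sum.swap)
    also have "\<dots> = (\<Sum>s\<in>insert s0 S. a s * (\<Sum>y\<in>X. b x y * e s y))"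
      by (simp only: sum_distrib_left mult.left_commute)
    also have "\<dots> = (\<Sum>s\<in>insert s0 S. a s * (s * e s x))"
      using insert.prems(1) x by (intro sum.cong) auto
    finally have 1: "(\<Sum>s\<in>insert s0 S. a s * (s * e s x)) = 0" by simp
    have "(\<Sum>s\<in>insert s0 S. a s * (s - s0) * e s x) =
       (\<Sum>s\<in>insert s0 S. a s * (s * e s x)) - s0 * (\<Sum>s\<in>insert s0 S. a s * e s x)"
      unfolding sum_distrib_left sum_subtractf[symmetric]
      by (intro sum.cong) (auto simp: algebra_simps)
    with 1 insert.prems(3) x have "(\<Sum>s\<in>insert s0 S. a s * (s - s0) * e s x) = 0"
      by simp
    then show ?thesis using insert.hyps by simp
  qed
  from insert.IH[of "\<lambda>s. a s * (s - s0)"] this insert.prems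
  have "\<forall>s\<in>S. a s * (s - s0) = 0" by blast
  then have a0: "\<forall>s\<in>S. a s = 0" using insert.hyps by auto
  obtain x where "x \<in> X" "e s0 x \<noteq> 0" using insert.prems(2) by blast
  with insert.prems(3) a0 insert.hyps have "a s0 = 0" by auto
  with a0 show ?case by simp
qed simp

text \<open>More than \<open>card X\<close> eigenvectors with distinct eigenvalues would be both
  dependent and independent; no determinant is involved.\<close>

lemma finite_eigenvalues:
  fixes b :: "'x \<Rightarrow> 'x \<Rightarrow> 'a::field"
  assumes "finite X"
    and "\<And>s. s \<in> S \<Longrightarrow> \<exists>e. (\<exists>x\<in>X. e x \<noteq> 0) \<and> (\<forall>x\<in>X. (\<Sum>y\<in>X. b x y * e y) = s * e x)"
  shows "finite S"
proof (rule ccontr)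
  assume "infinite S"
  then obtain T where T: "T \<subseteq> S" "finite T" "card T = Suc (card X)"
    by (meson infinite_arbitrarily_large)
  obtain e where e: "\<And>s. s \<in> S \<Longrightarrow> (\<exists>x\<in>X. e s x \<noteq> 0) \<and> (\<forall>x\<in>X. (\<Sum>y\<in>X. b x y * e s y) = s * e s x)"
    using assms(2) by metis
  obtain a where "\<exists>s\<in>T. a s \<noteq> 0" "\<forall>x\<in>X. (\<Sum>s\<in>T. a s * e s x) = 0"
    using linear_dependence[OF \<open>finite X\<close> \<open>finite T\<close>, of e] T(3) by auto
  with eigenvectors_independent[OF \<open>finite X\<close> \<open>finite T\<close>, of b e a] e T(1) show False by blast
qed

text \<open>The induction of Halmos and Vaughan: a tight proper subset splits the problem into two
  smaller ones, and without a tight subset any single choice leaves enough room for the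
  rest.\<close>

theorem hall_marriage:
  fixes A :: "'i \<Rightarrow> 'b set"
  assumes "finite I" "\<And>i. i \<in> I \<Longrightarrow> finite (A i)"
    and "\<And>J. J \<subseteq> I \<Longrightarrow> card J \<le> card (\<Union>(A ` J))"
  shows "\<exists>f. inj_on f I \<and> (\<forall>i\<in>I. f i \<in> A i)"
  using assms
proof (induction "card I" arbitrary: I A rule: less_induct)
  case less
  note fin = \<open>finite I\<close> and finA = less.prems(2) and hall = less.prems(3)
  have finU: "finite (\<Union>(A ` J))" if "J \<subseteq> I" for J
    using that fin finA finite_subset by blast
  show ?case
  proof (cases "I = {}")
    case False
    then obtain i where i: "i \<in> I" by blast
    show ?thesis
    proof (cases "\<exists>J. J \<noteq> {} \<and> J \<subset> I \<and> card (\<Union>(A ` J)) = card J")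
      case True
      then obtain J where J: "J \<noteq> {}" "J \<subset> I" "card (\<Union>(A ` J)) = card J" by blast
      define U where "U = \<Union>(A ` J)"
      have finJ: "finite J" using J fin finite_subset by blast
      have "card J < card I" using J fin by (simp add: psubset_card_mono)
      then have "\<exists>f. inj_on f J \<and> (\<forall>i\<in>J. f i \<in> A i)"
        using J(2) by (intro less.hyps finJ finA hall) auto
      then obtain f where f: "inj_on f J" "\<forall>i\<in>J. f i \<in> A i" by blast
      have lt: "card (I - J) < card I"
        using J fin by (intro psubset_card_mono) auto
      \<comment> \<open>Since \<open>J\<close> has exactly \<open>card J\<close> neighbours, Hall's
        condition for \<open>L \<union> J\<close> leaves \<open>card L\<close> neighbours of
        \<open>L\<close> outside \<open>U\<close>.\<close>
      have "card L \<le> card (\<Union>((\<lambda>i. A i - U) ` L))" if L: "L \<subseteq> I - J" for L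
      proof -
        have finL: "finite L" using L fin finite_subset by blast
        have "card L + card J = card (L \<union> J)"
          using L finL finJ by (intro card_Un_disjoint[symmetric]) auto
        also have "\<dots> \<le> card (\<Union>(A ` (L \<union> J)))"
          using L J(2) by (intro hall) auto
        also have "\<Union>(A ` (L \<union> J)) = \<Union>((\<lambda>i. A i - U) ` L) \<union> U"
          by (auto simp: U_def)
        also have "card \<dots> \<le> card (\<Union>((\<lambda>i. A i - U) ` L)) + card U"
          by (rule card_Un_le)
        finally show ?thesis using J(3) by (simp add: U_def)
      qed
      then have "\<exists>h. inj_on h (I - J) \<and> (\<forall>i\<in>I - J. h i \<in> A i - U)"
        using lt fin finA by (intro less.hyps) auto
      then obtain h where h: "inj_on h (I - J)" "\<forall>i\<in>I - J. h i \<in> A i - U" by blast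
      define k where "k = (\<lambda>i. if i \<in> J then f i else h i)"
      have "f i \<in> U" if "i \<in> J" for i using f that by (auto simp: U_def)
      then have fh: "f i \<noteq> h j" if "i \<in> J" "j \<in> I - J" for i j using that h(2) by (metis DiffE)
      have "k i \<noteq> k j" if "i \<in> I" "j \<in> I" "i \<noteq> j" for i j
        using that inj_onD[OF f(1), of i j] inj_onD[OF h(1), of i j] fh[of i j] fh[of j i]
        unfolding k_def by (cases "i \<in> J"; cases "j \<in> J") (auto dest: sym)
      then have "inj_on k I" by (auto simp: inj_on_def)
      moreover have "\<forall>i\<in>I. k i \<in> A i" using f h by (auto simp: k_def)
      ultimately show ?thesis by blast
    next
      case False
      have "card {i} \<le> card (\<Union>(A ` {i}))" by (rule hall) (use i in auto)
      then have "A i \<noteq> {}" by auto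
      then obtain x where x: "x \<in> A i" by blast
      have lt: "card (I - {i}) < card I"
        using i fin by (rule card_Diff1_less[rotated])
      \<comment> \<open>Without tight subsets a nonempty \<open>L\<close> has a neighbour to spare,
        so the loss of \<open>x\<close> does no harm.\<close>
      have "card L \<le> card (\<Union>((\<lambda>i. A i - {x}) ` L))" if L: "L \<subseteq> I - {i}" for L
      proof (cases "L = {}")
        case False
        have "L \<subset> I" using L i by blast
        with False \<open>\<not> (\<exists>J. _ J)\<close> have "card (\<Union>(A ` L)) \<noteq> card L" by blast
        moreover have "card L \<le> card (\<Union>(A ` L))" by (rule hall) (use L in auto)
        ultimately have "card L \<le> card (\<Union>(A ` L)) - 1" by simp
        also have "\<dots> \<le> card (\<Union>(A ` L) - {x})"
          using finU[of L] \<open>L \<subset> I\<close> by (simp add: card_Diff_singleton_if)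
        also have "\<Union>(A ` L) - {x} = \<Union>((\<lambda>i. A i - {x}) ` L)" by auto
        finally show ?thesis .
      qed simp
      then have "\<exists>h. inj_on h (I - {i}) \<and> (\<forall>j\<in>I - {i}. h j \<in> A j - {x})"
        using lt fin finA by (intro less.hyps) auto
      then obtain h where h: "inj_on h (I - {i})" "\<forall>j\<in>I - {i}. h j \<in> A j - {x}" by blast
      have "inj_on (h(i := x)) I"
        using h unfolding inj_on_def by (auto split: if_splits)
      moreover have "\<forall>j\<in>I. (h(i := x)) j \<in> A j" using h x by auto
      ultimately show ?thesis by blast
    qed
  qed simp
qed

section \<open>Polynomial functions\<close>

text \<open>With the pointwise product this makes functions a complex algebra. Polynomials are
  treated as functions throughout, and ideals as subspaces closed under multiplication by
  polynomials.\<close>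

definition fscale :: "complex \<Rightarrow> ('a \<Rightarrow> complex) \<Rightarrow> 'a \<Rightarrow> complex" where
  "fscale c f = (\<lambda>x. c * f x)"

interpretation fs: vector_space "fscale :: complex \<Rightarrow> ('a \<Rightarrow> complex) \<Rightarrow> 'a \<Rightarrow> complex"
  by standard (auto simp: fscale_def fun_eq_iff algebra_simps)

lemma fscale_mult_left: "fscale c f * g = fscale c (f * g)"
  and fscale_mult_right: "g * fscale c f = fscale c (g * f)"
  by (auto simp: fscale_def fun_eq_iff)

lemma sum_fun_apply: "(\<Sum>i\<in>I. f i) x = (\<Sum>i\<in>I. f i x)"
  by (induction I rule: infinite_finite_induct) auto

lemma power_fun_apply: "(f ^ n) x = (f x :: complex) ^ n"
  by (induction n) auto

lemma span_mult:
  assumes "f \<in> fs.span A" "g \<in> fs.span B"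
    and "\<And>a b. a \<in> A \<Longrightarrow> b \<in> B \<Longrightarrow> a * b \<in> fs.span C"
  shows "f * g \<in> fs.span C"
  using assms(1)
proof (induction f rule: fs.span_induct_alt)
  case base
  show ?case unfolding mult_zero_left by (rule fs.span_zero)
next
  case (step c a f)
  have "a * g \<in> fs.span C"
    using assms(2)
  proof (induction g rule: fs.span_induct_alt)
    case base
    show ?case unfolding mult_zero_right by (rule fs.span_zero)
  next
    case (step d b g)
    then show ?case using assms(3)[OF \<open>a \<in> A\<close>]
      unfolding distrib_left fscale_mult_right by (intro fs.span_add fs.span_scale)
  qed
  with step show ?case
    unfolding distrib_right fscale_mult_left by (intro fs.span_add fs.span_scale)
qed

text \<open>Exponents are total functions whose values off \<open>V\<close> do not matter;
  \<open>restrict \<alpha> V\<close> is the representative used wherever exponents are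
  counted.\<close>

definition mon :: "'v set \<Rightarrow> ('v \<Rightarrow> nat) \<Rightarrow> ('v \<Rightarrow> complex) \<Rightarrow> complex" where
  "mon V \<alpha> = (\<lambda>p. \<Prod>v\<in>V. p v ^ \<alpha> v)"

lemma mon_mult: "mon V \<alpha> * mon V \<beta> = mon V (\<alpha> + \<beta>)"
  by (auto simp: mon_def fun_eq_iff prod.distrib power_add)

lemma mon_power: "mon V \<alpha> ^ n = mon V (\<lambda>v. n * \<alpha> v)"
  by (auto simp: mon_def fun_eq_iff power_fun_apply prod_power_distrib power_mult[symmetric] mult.commute)

lemma mon_cong: "(\<And>v. v \<in> V \<Longrightarrow> \<alpha> v = \<beta> v) \<Longrightarrow> mon V \<alpha> = mon V \<beta>"
  by (auto simp: mon_def fun_eq_iff)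

lemma mon_restrict: "mon V (restrict \<alpha> V) = mon V \<alpha>"
  by (rule mon_cong) simp

lemma mon_0: "mon V (\<lambda>_. 0) = 1"
  by (auto simp: mon_def fun_eq_iff)

lemma mon_sum:
  assumes "finite V" "finite I" "c ` I \<subseteq> V" "inj_on c I"
  shows "mon V (\<lambda>v. if v \<in> c ` I then n else 0) = (\<lambda>p. \<Prod>i\<in>I. p (c i) ^ n)"
proof
  fix p
  have "mon V (\<lambda>v. if v \<in> c ` I then n else 0) p = (\<Prod>v\<in>V. if v \<in> c ` I then p v ^ n else 1)"
    unfolding mon_def by (intro prod.cong) auto
  also have "\<dots> = (\<Prod>v\<in>c ` I. p v ^ n)"
    using assms by (simp add: prod.inter_restrict[symmetric] Int_absorb1 Int_absorb2)
  also have "\<dots> = (\<Prod>i\<in>I. p (c i) ^ n)"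
    using assms by (simp add: prod.reindex)
  finally show "mon V (\<lambda>v. if v \<in> c ` I then n else 0) p = (\<Prod>i\<in>I. p (c i) ^ n)" .
qed

definition polys :: "'v set \<Rightarrow> (('v \<Rightarrow> complex) \<Rightarrow> complex) set" where
  "polys V = fs.span (range (mon V))"

lemma mon_in_polys: "mon V \<alpha> \<in> polys V"
  by (auto simp: polys_def intro: fs.span_base)

lemma polys_mult: "f \<in> polys V \<Longrightarrow> g \<in> polys V \<Longrightarrow> f * g \<in> polys V"
  unfolding polys_def by (erule (1) span_mult) (auto simp: mon_mult intro: fs.span_base)

lemma one_in_polys: "1 \<in> polys V"
  using mon_in_polys[of V "\<lambda>_. 0"] by (simp add: mon_0)

lemma const_eq_fscale: "(\<lambda>_. c) = fscale c 1"
  by (auto simp: fscale_def)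

lemma const_in_polys: "(\<lambda>_. c) \<in> polys V"
  unfolding const_eq_fscale using one_in_polys unfolding polys_def by (rule fs.span_scale)

lemma polys_power: "f \<in> polys V \<Longrightarrow> f ^ n \<in> polys V"
  by (induction n) (auto intro: polys_mult one_in_polys)

lemma coord_eq_mon:
  assumes "finite V" "v \<in> V"
  shows "(\<lambda>p. p v) = mon V (\<lambda>w. if w = v then 1 else 0)"
proof -
  have "(\<lambda>w. if w \<in> (\<lambda>_. v) ` {()} then 1 else 0) = (\<lambda>w. if w = v then 1 else 0 :: nat)" by auto
  with mon_sum[of V "{()}" "\<lambda>_. v" 1] assms show ?thesis by simp
qed

lemma poly_coord_in_polys:
  assumes "finite V" "v \<in> V"
  shows "(\<lambda>p. poly r (p v)) \<in> polys V"
proof (induction r)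
  case 0
  then show ?case using const_in_polys[of 0] by simp
next
  case (pCons a r)
  have "(\<lambda>p. poly (pCons a r) (p v)) = (\<lambda>_. a) + (\<lambda>p. p v) * (\<lambda>p. poly r (p v))"
    by (auto simp: fun_eq_iff)
  moreover have "(\<lambda>p. p v) * (\<lambda>p. poly r (p v)) \<in> polys V"
    using pCons.IH coord_eq_mon[OF assms] by (metis polys_mult mon_in_polys)
  ultimately show ?case
    using const_in_polys[of a V] unfolding polys_def by (metis fs.span_add)
qed

text \<open>Restricted exponents confine the support to a countable or even finite set, as the
  pigeonhole and dimension arguments require.\<close>

lemma span_mon_finite_support:
  assumes "f \<in> fs.span (mon V ` S)"
  shows "\<exists>T c. finite T \<and> T \<subseteq> (\<lambda>\<alpha>. restrict \<alpha> V) ` S \<and> f = (\<lambda>p. \<Sum>\<alpha>\<in>T. c \<alpha> * mon V \<alpha> p)"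
proof -
  have "mon V ` S = mon V ` ((\<lambda>\<alpha>. restrict \<alpha> V) ` S)"
    by (simp add: image_image mon_restrict)
  then obtain t r where t: "finite t" "t \<subseteq> mon V ` ((\<lambda>\<alpha>. restrict \<alpha> V) ` S)"
      "f = (\<Sum>a\<in>t. fscale (r a) a)"
    using assms unfolding fs.span_explicit by auto
  \<comment> \<open>Taking one exponent per member of \<open>t\<close> makes \<open>mon V\<close>
    injective on \<open>T\<close>, with no need to show that distinct restricted exponents give
    distinct functions.\<close>
  obtain T where T: "T \<subseteq> (\<lambda>\<alpha>. restrict \<alpha> V) ` S" "inj_on (mon V) T" "t = mon V ` T"
    using t(2) by (meson subset_image_inj)
  have "finite T" using T t(1) finite_imageD by blast
  moreover have "f = (\<lambda>p. \<Sum>\<alpha>\<in>T. r (mon V \<alpha>) * mon V \<alpha> p)"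
    unfolding t(3) T(3) using T(2)
    by (auto simp: fun_eq_iff sum_fun_apply sum.reindex fscale_def)
  ultimately show ?thesis using T(1)
    by (intro exI[of _ T] exI[of _ "\<lambda>\<alpha>. r (mon V \<alpha>)"]) auto
qed

section \<open>Hilbert's Nullstellensatz\<close>

lemma countable_exponents: "finite V \<Longrightarrow> countable (range (\<lambda>\<alpha> :: 'v \<Rightarrow> nat. restrict \<alpha> V))"
  by (rule countable_subset[of _ "PiE V (\<lambda>_. UNIV)"]) (auto intro: countable_PiE)

text \<open>A submodule of the ring of all functions, not only of polynomial functions.\<close>

definition poly_submodule :: "'v set \<Rightarrow> (('v \<Rightarrow> complex) \<Rightarrow> complex) set \<Rightarrow> bool" where
  "poly_submodule V P \<longleftrightarrow> fs.subspace P \<and> (\<forall>f\<in>polys V. \<forall>g\<in>P. f * g \<in> P)"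

lemma poly_submodule_add: "poly_submodule V P \<Longrightarrow> f \<in> P \<Longrightarrow> g \<in> P \<Longrightarrow> f + g \<in> P"
  and poly_submodule_diff: "poly_submodule V P \<Longrightarrow> f \<in> P \<Longrightarrow> g \<in> P \<Longrightarrow> f - g \<in> P"
  and poly_submodule_scale: "poly_submodule V P \<Longrightarrow> f \<in> P \<Longrightarrow> fscale c f \<in> P"
  and poly_submodule_mult: "poly_submodule V P \<Longrightarrow> h \<in> polys V \<Longrightarrow> f \<in> P \<Longrightarrow> h * f \<in> P"
  and poly_submodule_0: "poly_submodule V P \<Longrightarrow> 0 \<in> P"
  by (auto simp: poly_submodule_def fs.subspace_add fs.subspace_diff fs.subspace_scale fs.subspace_0)

lemma poly_submodule_sum:
  "poly_submodule V P \<Longrightarrow> (\<And>i. i \<in> I \<Longrightarrow> f i \<in> P) \<Longrightarrow> sum f I \<in> P"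
  by (auto simp: poly_submodule_def fs.subspace_sum)

lemma poly_submodule_insert:
  assumes "poly_submodule V P"
  shows "poly_submodule V {x + u * a | x u. x \<in> P \<and> u \<in> polys V}"
  unfolding poly_submodule_def
proof (intro conjI fs.subspaceI ballI)
  note P = poly_submodule_add[OF assms] poly_submodule_scale[OF assms]
    poly_submodule_mult[OF assms] poly_submodule_0[OF assms]
  let ?Q = "{x + u * a | x u. x \<in> P \<and> u \<in> polys V}"
  have z: "0 \<in> polys V" unfolding polys_def by (rule fs.span_zero)
  show "0 \<in> ?Q" using P(4) z by (auto intro!: exI[of _ 0])
  fix f g assume "f \<in> ?Q" "g \<in> ?Q"
  then obtain x u y w where *: "f = x + u * a" "g = y + w * a" "x \<in> P" "y \<in> P" "u \<in> polys V" "w \<in> polys V"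
    by blast
  then have "f + g = (x + y) + (u + w) * a" by (simp add: algebra_simps)
  moreover have "u + w \<in> polys V" using * unfolding polys_def by (auto intro: fs.span_add)
  ultimately show "f + g \<in> ?Q" using P(1)[OF *(3,4)] by blast
next
  let ?Q = "{x + u * a | x u. x \<in> P \<and> u \<in> polys V}"
  fix c f assume "f \<in> ?Q"
  then obtain x u where *: "f = x + u * a" "x \<in> P" "u \<in> polys V" by blast
  then have "fscale c f = fscale c x + fscale c u * a"
    by (simp add: fscale_mult_left fs.scale_right_distrib)
  moreover have "fscale c u \<in> polys V" using * unfolding polys_def by (auto intro: fs.span_scale)
  ultimately show "fscale c f \<in> ?Q" using poly_submodule_scale[OF assms *(2)] by blast
next
  let ?Q = "{x + u * a | x u. x \<in> P \<and> u \<in> polys V}"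
  fix h f assume h: "h \<in> polys V" and "f \<in> ?Q"
  then obtain x u where *: "f = x + u * a" "x \<in> P" "u \<in> polys V" by blast
  then have "h * f = h * x + (h * u) * a" by (simp add: algebra_simps)
  then show "h * f \<in> ?Q" using poly_submodule_mult[OF assms h *(2)] polys_mult[OF h *(3)] by blast
qed

lemma poly_submodule_span:
  assumes "F \<subseteq> polys V"
  shows "poly_submodule V (fs.span {mon V \<alpha> * f | \<alpha> f. f \<in> F})"
  unfolding poly_submodule_def
proof (intro conjI ballI fs.subspace_span)
  fix f g assume "f \<in> polys V" "g \<in> fs.span {mon V \<alpha> * f | \<alpha> f. f \<in> F}"
  then show "f * g \<in> fs.span {mon V \<alpha> * f | \<alpha> f. f \<in> F}"
    unfolding polys_def
    by (rule span_mult) (auto simp: mult.assoc[symmetric] mon_mult intro!: fs.span_base, blast)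
qed

text \<open>Over an uncountable field a ring of countable dimension that is a field is algebraic, because
  the inverses of the elements \<open>x - c\<close> are linearly independent when \<open>x\<close> is transcendental.\<close>

lemma maximal_submodule_coord:
  assumes V: "finite V" "v \<in> V" and P: "poly_submodule V P"
    and m: "m \<in> polys V" "\<And>d. m ^ d \<notin> P"
    and max: "\<And>Q. poly_submodule V Q \<Longrightarrow> P \<subseteq> Q \<Longrightarrow> (\<And>d. m ^ d \<notin> Q) \<Longrightarrow> Q = P"
  shows "\<exists>c. (\<lambda>p. p v - c) \<in> P"
proof (rule ccontr)
  assume no: "\<not> ?thesis"
  let ?l = "\<lambda>c p. p v - c :: complex"
  \<comment> \<open>Modulo \<open>P\<close>, the polynomial \<open>u\<close> inverts
    \<open>p v - c\<close> up to a power of \<open>m\<close>: adding \<open>p v - c\<close> to the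
    maximal \<open>P\<close> must bring in such a power.\<close>
  have "\<exists>d u. u \<in> polys V \<and> m ^ d - u * ?l c \<in> P" for c
  proof -
    let ?Q = "{x + u * ?l c | x u. x \<in> P \<and> u \<in> polys V}"
    have "0 + 1 * ?l c \<in> ?Q" using poly_submodule_0[OF P] one_in_polys by blast
    then have "?l c \<in> ?Q" by simp
    then have "?Q \<noteq> P" using no by blast
    moreover have "P \<subseteq> ?Q"
    proof
      fix x assume "x \<in> P"
      moreover have "x = x + 0 * ?l c" by simp
      moreover have "0 \<in> polys V" unfolding polys_def by (rule fs.span_zero)
      ultimately show "x \<in> ?Q" by blast
    qed
    ultimately obtain d where "m ^ d \<in> ?Q"
      using max[OF poly_submodule_insert[OF P]] by blast
    then obtain x u where "m ^ d = x + u * ?l c" "x \<in> P" "u \<in> polys V" by blast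
    then show ?thesis by (intro exI[of _ d] exI[of _ u]) simp
  qed
  then have "\<forall>c. \<exists>du. snd du \<in> polys V \<and> m ^ fst du - snd du * ?l c \<in> P" by auto
  from choice[OF this] obtain du
    where du: "\<forall>c. snd (du c) \<in> polys V \<and> m ^ fst (du c) - snd (du c) * ?l c \<in> P" by blast
  define d u where "d = fst \<circ> du" and "u = snd \<circ> du"
  have u: "u c \<in> polys V" "m ^ d c - u c * ?l c \<in> P" for c
    using du by (auto simp: d_def u_def)
  define R where "R = (\<lambda>c T a. finite T \<and> T \<subseteq> range (\<lambda>\<alpha>. restrict \<alpha> V) \<and>
    u c = (\<lambda>p. \<Sum>\<alpha>\<in>T. a \<alpha> * mon V \<alpha> p))"
  have "\<exists>T a. R c T a" for c
    using u(1)[of c] unfolding R_def polys_def by (rule span_mon_finite_support)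
  then obtain T a where "\<And>c. R c (T c) (a c)" by metis
  then have T: "finite (T c)" "T c \<subseteq> range (\<lambda>\<alpha>. restrict \<alpha> V)"
    and a: "u c = (\<lambda>p. \<Sum>\<alpha>\<in>T c. a c \<alpha> * mon V \<alpha> p)" for c
    by (auto simp: R_def)
  \<comment> \<open>There are only countably many pairs of an exponent of \<open>m\<close> and a
    support of \<open>u c\<close>, so infinitely many \<open>c\<close> share one pair. More of these
    than monomials in the support give a linear relation among the \<open>u c\<close>.\<close>
  define key where "key = (\<lambda>c. (d c, T c))"
  have "range key \<subseteq> UNIV \<times> Fpow (range (\<lambda>\<alpha>. restrict \<alpha> V))"
    using T by (auto simp: key_def Fpow_def)
  then have cnt: "countable (range key)"
    using countable_Fpow[OF countable_exponents[OF V(1)]] by (meson countable_SIGMA countable_subset countableI_type)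
  have "\<exists>k. infinite {c. key c = k}"
  proof (rule ccontr)
    assume "\<nexists>k. infinite {c. key c = k}"
    then have "countable (\<Union>k\<in>range key. {c. key c = k})"
      by (intro countable_UN cnt) (auto intro: countable_finite)
    moreover have "(\<Union>k\<in>range key. {c. key c = k}) = UNIV" by auto
    ultimately show False using uncountable_UNIV_complex by simp
  qed
  then obtain D S where inf: "infinite {c. key c = (D, S)}" by auto
  then obtain c0 where "key c0 = (D, S)" using infinite_imp_nonempty by blast
  then have S: "finite S" using T(1) by (auto simp: key_def)
  obtain C where C: "finite C" "card C = Suc (card S)" "C \<subseteq> {c. key c = (D, S)}"
    using infinite_arbitrarily_large[OF inf] by blast
  obtain b where b: "\<exists>c\<in>C. b c \<noteq> 0" "\<forall>\<alpha>\<in>S. (\<Sum>c\<in>C. b c * a c \<alpha>) = 0"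
    using linear_dependence[OF S C(1), of a] C(2) by auto
  have bu: "(\<Sum>c\<in>C. b c * u c p) = 0" for p
  proof -
    have "(\<Sum>c\<in>C. b c * u c p) = (\<Sum>c\<in>C. \<Sum>\<alpha>\<in>S. b c * a c \<alpha> * mon V \<alpha> p)"
      using C(3) by (intro sum.cong) (auto simp: a key_def sum_distrib_left mult.assoc)
    also have "\<dots> = (\<Sum>\<alpha>\<in>S. (\<Sum>c\<in>C. b c * a c \<alpha>) * mon V \<alpha> p)"
      by (subst sum.swap) (simp add: sum_distrib_right)
    finally show ?thesis using b(2) by simp
  qed
  \<comment> \<open>Lagrange products clear the denominators in the relation among the inverses of
    \<open>p v - c\<close>. At \<open>c1\<close> a single nonzero term of \<open>r\<close> survives,
    so \<open>r\<close> is not zero.\<close>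
  define q where "q = (\<lambda>c. \<Prod>c'\<in>C - {c}. [:- c', 1:])"
  define r where "r = (\<Sum>c\<in>C. smult (b c) (q c))"
  have q_split: "poly (q c) x * (x - c) = (\<Prod>c'\<in>C. x - c')" if "c \<in> C" for c x
    using C(1) that by (simp add: q_def poly_prod prod.remove mult.commute)
  obtain c1 where c1: "c1 \<in> C" "b c1 \<noteq> 0" using b by blast
  have "poly (q c) c1 = 0" if "c \<in> C" "c \<noteq> c1" for c
    using that c1 C(1) by (auto simp: q_def poly_prod)
  then have "poly r c1 = b c1 * poly (q c1) c1"
    using c1 C(1) by (simp add: r_def poly_sum sum.remove[of C c1])
  moreover have "poly (q c1) c1 \<noteq> 0"
    using C(1) by (auto simp: q_def poly_prod)
  ultimately have "r \<noteq> 0" using c1 by auto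
  have "(\<lambda>p. poly r (p v)) * m ^ D = (\<Sum>c\<in>C. fscale (b c) ((\<lambda>p. poly (q c) (p v)) * (m ^ D - u c * ?l c)))"
  proof
    fix p
    have "(\<Sum>c\<in>C. fscale (b c) ((\<lambda>p. poly (q c) (p v)) * (m ^ D - u c * ?l c))) p
      = (\<Sum>c\<in>C. b c * poly (q c) (p v) * (m ^ D) p - (\<Prod>c'\<in>C. p v - c') * (b c * u c p))"
      unfolding sum_fun_apply
    proof (intro sum.cong refl)
      fix c assume "c \<in> C"
      show "fscale (b c) ((\<lambda>p. poly (q c) (p v)) * (m ^ D - u c * ?l c)) p =
        b c * poly (q c) (p v) * (m ^ D) p - (\<Prod>c'\<in>C. p v - c') * (b c * u c p)"
        unfolding q_split[OF \<open>c \<in> C\<close>, symmetric] by (simp add: fscale_def algebra_simps)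
    qed
    also have "\<dots> = poly r (p v) * (m ^ D) p"
      using bu[of p] by (simp add: sum_subtractf r_def poly_sum sum_distrib_right sum_distrib_left[symmetric])
    finally show "((\<lambda>p. poly r (p v)) * m ^ D) p = (\<Sum>c\<in>C. fscale (b c) ((\<lambda>p. poly (q c) (p v)) * (m ^ D - u c * ?l c))) p"
      by simp
  qed
  also have "\<dots> \<in> P"
  proof (intro poly_submodule_sum[OF P] poly_submodule_scale[OF P] poly_submodule_mult[OF P] poly_coord_in_polys V)
    fix c assume "c \<in> C"
    then have "d c = D" using C(3) by (auto simp: key_def)
    then show "m ^ D - u c * ?l c \<in> P" using u(2)[of c] by simp
  qed
  finally have "(\<lambda>p. poly r (p v)) * m ^ D \<in> P" .
  \<comment> \<open>Linear factors of \<open>r\<close> are removed one at a time, each at the price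
    of a higher power of \<open>m\<close>, until a nonzero constant times a power of
    \<open>m\<close> lies in \<open>P\<close>.\<close>
  then show False using \<open>r \<noteq> 0\<close>
  proof (induction "degree r" arbitrary: r D)
    case 0
    then obtain k where k: "r = [:k:]" "k \<noteq> 0" by (metis degree_eq_zeroE pCons_0_0)
    have "m ^ D = fscale (1 / k) ((\<lambda>p. poly r (p v)) * m ^ D)"
      using k by (auto simp: fscale_def)
    then show False using 0 poly_submodule_scale[OF P] m(2) by metis
  next
    case (Suc n)
    then have "\<not> constant (poly r)" by (simp add: constant_degree)
    then obtain z where "poly r z = 0" using fundamental_theorem_of_algebra by blast
    then obtain r' where r': "r = [:-z, 1:] * r'" by (auto simp: poly_eq_0_iff_dvd elim: dvdE)
    have "r' \<noteq> 0" using r' Suc by auto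
    moreover have "degree r = degree [:-z, 1:] + degree r'"
      unfolding r' using \<open>r' \<noteq> 0\<close> by (intro degree_mult_eq) auto
    then have "n = degree r'" using Suc(2) by simp
    moreover have "(\<lambda>p. poly r' (p v)) * m ^ (D + d z) \<in> P"
    proof -
      have "(\<lambda>p. poly r' (p v)) * m ^ (D + d z) =
         ((\<lambda>p. poly r' (p v)) * m ^ D) * (m ^ d z - u z * ?l z) + u z * ((\<lambda>p. poly r (p v)) * m ^ D)"
        unfolding r' by (auto simp: fun_eq_iff power_fun_apply power_add algebra_simps)
      also have "\<dots> \<in> P"
        by (intro poly_submodule_add[OF P] poly_submodule_mult[OF P] polys_mult polys_power
            poly_coord_in_polys V m u Suc.prems)
      finally show ?thesis .
    qed
    ultimately show False using Suc.hyps(1) by blast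
  qed
qed

text \<open>Maximality is taken among submodules that avoid all powers of \<open>m\<close>, not
  among proper ideals; this gives the radical form directly, with no auxiliary variable. Modulo such
  a \<open>P\<close> the coordinates are constants, and these constants form a common zero of
  \<open>F\<close>, which forces \<open>m\<close> into \<open>P\<close>.\<close>

theorem nullstellensatz:
  assumes V: "finite V" and F: "F \<subseteq> polys V" and m: "m \<in> polys V"
    and van: "\<And>p. (\<And>f. f \<in> F \<Longrightarrow> f p = 0) \<Longrightarrow> m p = 0"
  shows "\<exists>d. m ^ d \<in> fs.span {mon V \<alpha> * f | \<alpha> f. f \<in> F}"
proof (rule ccontr)
  let ?I = "fs.span {mon V \<alpha> * f | \<alpha> f. f \<in> F}"
  assume no: "\<not> ?thesis"
  define Z where "Z = {P. poly_submodule V P \<and> ?I \<subseteq> P \<and> (\<forall>d. m ^ d \<notin> P)}"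
  have "\<exists>P\<in>Z. \<forall>X\<in>Z. P \<subseteq> X \<longrightarrow> X = P"
  proof (rule subset_Zorn_nonempty)
    show "Z \<noteq> {}" using poly_submodule_span[OF F] no by (auto simp: Z_def)
    fix \<C> assume ne: "\<C> \<noteq> {}" and ch: "subset.chain Z \<C>"
    have CZ: "\<C> \<subseteq> Z" using ch by (auto simp: subset_chain_def)
    have sub: "poly_submodule V A" if "A \<in> \<C>" for A using CZ that by (auto simp: Z_def)
    have "poly_submodule V (\<Union>\<C>)"
      unfolding poly_submodule_def
    proof (intro conjI fs.subspaceI ballI)
      show "0 \<in> \<Union>\<C>" using ne sub poly_submodule_0 by blast
      fix f g assume "f \<in> \<Union>\<C>" "g \<in> \<Union>\<C>"
      then obtain A B where "A \<in> \<C>" "B \<in> \<C>" "f \<in> A" "g \<in> B" by blast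
      moreover from this have "A \<subseteq> B \<or> B \<subseteq> A" using ch by (auto simp: subset_chain_def)
      ultimately obtain D where "D \<in> \<C>" "f \<in> D" "g \<in> D" by blast
      then show "f + g \<in> \<Union>\<C>" using sub poly_submodule_add by blast
    next
      fix c f assume "f \<in> \<Union>\<C>"
      then show "fscale c f \<in> \<Union>\<C>" using sub poly_submodule_scale by blast
    next
      fix h f assume "h \<in> polys V" "f \<in> \<Union>\<C>"
      then show "h * f \<in> \<Union>\<C>" using sub poly_submodule_mult by blast
    qed
    then show "\<Union>\<C> \<in> Z" using ne CZ by (auto simp: Z_def)
  qed
  then obtain P where PZ: "P \<in> Z" and max: "\<And>X. X \<in> Z \<Longrightarrow> P \<subseteq> X \<Longrightarrow> X = P" by blast
  have P: "poly_submodule V P" and IP: "?I \<subseteq> P" and mP: "\<And>d. m ^ d \<notin> P"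
    using PZ by (auto simp: Z_def)
  have "\<exists>c. (\<lambda>p. p v - c) \<in> P" if "v \<in> V" for v
    by (rule maximal_submodule_coord[OF V that P m mP]) (use max IP in \<open>auto simp: Z_def\<close>)
  then obtain c where c: "\<And>v. v \<in> V \<Longrightarrow> (\<lambda>p. p v - c v) \<in> P" by metis
  \<comment> \<open>\<open>A\<close> consists of the polynomials that agree modulo \<open>P\<close>
    with their value at \<open>c\<close>. It contains the coordinates and is closed under products,
    hence contains every monomial.\<close>
  define A where "A = {f \<in> polys V. f - (\<lambda>_. f c) \<in> P}"
  have A_mult: "f * g \<in> A" if "f \<in> A" "g \<in> A" for f g
  proof -
    have "f * g - (\<lambda>_. (f * g) c) = g * (f - (\<lambda>_. f c)) + fscale (f c) (g - (\<lambda>_. g c))"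
      by (auto simp: fun_eq_iff fscale_def algebra_simps)
    also have "\<dots> \<in> P"
      using that by (intro poly_submodule_add[OF P] poly_submodule_mult[OF P] poly_submodule_scale[OF P])
        (auto simp: A_def)
    finally show ?thesis using that by (auto simp: A_def polys_mult)
  qed
  have A_one: "1 \<in> A"
    using poly_submodule_0[OF P] one_in_polys by (simp add: A_def one_fun_def)
  have A_pow: "f ^ n \<in> A" if "f \<in> A" for f n
    by (induction n) (simp_all only: power_0 power_Suc A_one A_mult that)
  have A_coord: "(\<lambda>p. p v) \<in> A" if "v \<in> V" for v
  proof -
    have "(\<lambda>p. p v) - (\<lambda>_. c v) = (\<lambda>p. p v - c v)" by auto
    moreover have "(\<lambda>p. p v) \<in> polys V" unfolding coord_eq_mon[OF V that] by (rule mon_in_polys)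
    ultimately show ?thesis using c[OF that] by (simp add: A_def)
  qed
  have A_mon: "mon V \<alpha> \<in> A" for \<alpha>
  proof -
    have "(\<Prod>v\<in>W. (\<lambda>p. p v) ^ \<alpha> v) \<in> A" if "W \<subseteq> V" for W
      using finite_subset[OF that V] that
    proof (induction W rule: finite_induct)
      case empty
      show ?case unfolding prod.empty by (rule A_one)
    next
      case (insert v W)
      then show ?case
        unfolding prod.insert[OF insert.hyps] by (intro A_mult A_pow A_coord) auto
    qed
    moreover have "(\<Prod>v\<in>W. (\<lambda>p. p v) ^ \<alpha> v) = mon W \<alpha>" for W
      by (induction W rule: infinite_finite_induct) (auto simp: mon_def fun_eq_iff power_fun_apply)
    ultimately show ?thesis by (metis order_refl)
  qed
  have A_all: "f - (\<lambda>_. f c) \<in> P" if "f \<in> polys V" for f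
    using that unfolding polys_def
  proof (induction f rule: fs.span_induct_alt)
    case base
    then show ?case using poly_submodule_0[OF P] by (simp add: zero_fun_def fun_diff_def)
  next
    case (step k g f)
    then have "g - (\<lambda>_. g c) \<in> P" using A_mon by (auto simp: A_def)
    then have "fscale k (g - (\<lambda>_. g c)) + (f - (\<lambda>_. f c)) \<in> P"
      using step by (intro poly_submodule_add[OF P] poly_submodule_scale[OF P])
    moreover have "fscale k g + f - (\<lambda>_. (fscale k g + f) c) = fscale k (g - (\<lambda>_. g c)) + (f - (\<lambda>_. f c))"
      by (auto simp: fun_eq_iff fscale_def algebra_simps)
    ultimately show ?case by (simp only:)
  qed
  \<comment> \<open>A nonzero value would put the constant 1, which is \<open>m ^ 0\<close>, into
    \<open>P\<close>.\<close>
  have "f c = 0" if f: "f \<in> F" for f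
  proof (rule ccontr)
    assume nz: "f c \<noteq> 0"
    have "mon V (\<lambda>_. 0) * f \<in> ?I" using f by (intro fs.span_base) blast
    then have "f \<in> P" using IP by (auto simp: mon_0)
    then have "f - (f - (\<lambda>_. f c)) \<in> P"
      using A_all[of f] f F by (blast intro: poly_submodule_diff[OF P])
    then have "fscale (1 / f c) (f - (f - (\<lambda>_. f c))) \<in> P" by (rule poly_submodule_scale[OF P])
    moreover have "fscale (1 / f c) (f - (f - (\<lambda>_. f c))) = m ^ 0"
      using nz by (auto simp: fscale_def fun_eq_iff)
    ultimately show False using mP by metis
  qed
  then have "m c = 0" by (rule van)
  then have "m ^ 1 \<in> P" using A_all[OF m] by (simp add: fun_diff_def)
  then show False using mP by blast
qed

section \<open>Multihomogeneous systems\<close>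

definition mdeg :: "'v set \<Rightarrow> ('v \<Rightarrow> 'g) \<Rightarrow> ('v \<Rightarrow> nat) \<Rightarrow> 'g \<Rightarrow> nat" where
  "mdeg V grp \<alpha> g = (\<Sum>v | v \<in> V \<and> grp v = g. \<alpha> v)"

definition multihomogeneous ::
  "'v set \<Rightarrow> ('v \<Rightarrow> 'g) \<Rightarrow> ('g \<Rightarrow> nat) \<Rightarrow> (('v \<Rightarrow> complex) \<Rightarrow> complex) set" where
  "multihomogeneous V grp \<delta> = fs.span (mon V ` {\<alpha>. \<forall>g\<in>grp ` V. mdeg V grp \<alpha> g = \<delta> g})"

text \<open>These \<open>p\<close> represent the points of a product of projective spaces with one
  factor per group of variables.\<close>

definition nondegenerate :: "'v set \<Rightarrow> ('v \<Rightarrow> 'g) \<Rightarrow> ('v \<Rightarrow> complex) \<Rightarrow> bool" where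
  "nondegenerate V grp p \<longleftrightarrow> (\<forall>g\<in>grp ` V. \<exists>v\<in>V. grp v = g \<and> p v \<noteq> 0)"

definition scale_group :: "('v \<Rightarrow> 'g) \<Rightarrow> 'g \<Rightarrow> complex \<Rightarrow> ('v \<Rightarrow> complex) \<Rightarrow> 'v \<Rightarrow> complex" where
  "scale_group grp g c p = (\<lambda>v. if grp v = g then c * p v else p v)"

lemma mdeg_restrict: "mdeg V grp (restrict \<alpha> V) = mdeg V grp \<alpha>"
  by (auto simp: mdeg_def fun_eq_iff)

lemma mdeg_add: "mdeg V grp (\<alpha> + \<beta>) g = mdeg V grp \<alpha> g + mdeg V grp \<beta> g"
  by (simp add: mdeg_def sum.distrib)

lemma mon_scale_group:
  assumes "finite V"
  shows "mon V \<alpha> (scale_group grp g c p) = c ^ mdeg V grp \<alpha> g * mon V \<alpha> p"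
proof -
  have "mon V \<alpha> (scale_group grp g c p) = (\<Prod>v\<in>V. (if grp v = g then c ^ \<alpha> v else 1) * p v ^ \<alpha> v)"
    unfolding mon_def scale_group_def by (intro prod.cong) (auto simp: power_mult_distrib)
  also have "\<dots> = (\<Prod>v\<in>V. if grp v = g then c ^ \<alpha> v else 1) * mon V \<alpha> p"
    by (simp add: prod.distrib mon_def)
  also have "(\<Prod>v\<in>V. if grp v = g then c ^ \<alpha> v else 1) = (\<Prod>v | v \<in> V \<and> grp v = g. c ^ \<alpha> v)"
    using assms by (simp add: prod.inter_filter)
  also have "\<dots> = c ^ mdeg V grp \<alpha> g"
    by (simp add: mdeg_def power_sum)
  finally show ?thesis .
qed

lemma multihomogeneous_scale_group:
  assumes "finite V" "g \<in> grp ` V" "f \<in> multihomogeneous V grp \<delta>"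
  shows "f (scale_group grp g c p) = c ^ \<delta> g * f p"
  using assms(3) unfolding multihomogeneous_def
proof (induction f rule: fs.span_induct_alt)
  case (step k a f)
  then obtain \<alpha> where "a = mon V \<alpha>" "mdeg V grp \<alpha> g = \<delta> g" using assms(2) by auto
  then have "a (scale_group grp g c p) = c ^ \<delta> g * a p"
    using mon_scale_group[OF assms(1), of \<alpha> grp g c p] by simp
  with step show ?case by (simp add: fscale_def algebra_simps)
qed simp

lemma mon_mult_multihomogeneous:
  assumes "f \<in> multihomogeneous V grp \<delta>"
    and "\<And>g. g \<in> grp ` V \<Longrightarrow> mdeg V grp \<alpha> g + \<delta> g = \<epsilon> g"
  shows "mon V \<alpha> * f \<in> multihomogeneous V grp \<epsilon>"
  unfolding multihomogeneous_def
proof (rule span_mult)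
  show "mon V \<alpha> \<in> fs.span {mon V \<alpha>}" by (auto intro: fs.span_base)
  show "f \<in> fs.span (mon V ` {\<alpha>. \<forall>g\<in>grp ` V. mdeg V grp \<alpha> g = \<delta> g})"
    using assms(1) by (simp add: multihomogeneous_def)
  fix a b assume "a \<in> {mon V \<alpha>}" "b \<in> mon V ` {\<alpha>. \<forall>g\<in>grp ` V. mdeg V grp \<alpha> g = \<delta> g}"
  then obtain \<beta> where \<beta>: "a = mon V \<alpha>" "b = mon V \<beta>" "\<forall>g\<in>grp ` V. mdeg V grp \<beta> g = \<delta> g" by auto
  then have "a * b = mon V (\<alpha> + \<beta>)" by (simp only: mon_mult)
  moreover have "\<forall>g\<in>grp ` V. mdeg V grp (\<alpha> + \<beta>) g = \<epsilon> g"
    using \<beta>(3) assms(2) by (simp only: mdeg_add) auto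
  ultimately show "a * b \<in> fs.span (mon V ` {\<alpha>. \<forall>g\<in>grp ` V. mdeg V grp \<alpha> g = \<epsilon> g})"
    by (intro fs.span_base) blast
qed

text \<open>Comparing coefficients of \<open>c\<close> after scaling one group of variables by \<open>c\<close>.\<close>

lemma homogeneous_part_group:
  fixes F :: "'t \<Rightarrow> ('v \<Rightarrow> complex) \<Rightarrow> complex"
  assumes "finite T"
    and F: "\<And>t c p. t \<in> T \<Longrightarrow> F t (scale_group grp g c p) = c ^ n t * F t p"
    and w: "\<And>c p. w (scale_group grp g c p) = c ^ D * w p"
    and eq: "\<And>p. w p = (\<Sum>t\<in>T. F t p)"
  shows "w p = (\<Sum>t | t \<in> T \<and> n t = D. F t p)"
proof -
  have "poly (monom (w p) D) c = poly (\<Sum>t\<in>T. monom (F t p) (n t)) c" for c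
    using eq[of "scale_group grp g c p"] F w
    by (simp add: poly_monom poly_sum mult.commute)
  then have "monom (w p) D = (\<Sum>t\<in>T. monom (F t p) (n t))"
    unfolding poly_eq_poly_eq_iff[symmetric] by (rule ext)
  then have "coeff (monom (w p) D) D = coeff (\<Sum>t\<in>T. monom (F t p) (n t)) D" by simp
  also have "\<dots> = (\<Sum>t\<in>T. if n t = D then F t p else 0)"
    by (simp add: coeff_sum)
  also have "\<dots> = (\<Sum>t | t \<in> T \<and> n t = D. F t p)"
    using assms(1) by (simp add: sum.inter_filter)
  finally show ?thesis by simp
qed

text \<open>The groups are filtered one after another. Arguing by scaling avoids any appeal to
  uniqueness of expansions in several variables.\<close>

lemma homogeneous_part:
  fixes F :: "'t \<Rightarrow> ('v \<Rightarrow> complex) \<Rightarrow> complex"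
  assumes "finite T" "finite G"
    and F: "\<And>t g c p. t \<in> T \<Longrightarrow> g \<in> G \<Longrightarrow> F t (scale_group grp g c p) = c ^ n t g * F t p"
    and w: "\<And>g c p. g \<in> G \<Longrightarrow> w (scale_group grp g c p) = c ^ D g * w p"
    and eq: "\<And>p. w p = (\<Sum>t\<in>T. F t p)"
  shows "w p = (\<Sum>t | t \<in> T \<and> (\<forall>g\<in>G. n t g = D g). F t p)"
  using \<open>finite G\<close> F w
proof (induction G arbitrary: p rule: finite_induct)
  case empty
  then show ?case using eq by simp
next
  case (insert g G)
  let ?T = "{t \<in> T. \<forall>g\<in>G. n t g = D g}"
  have "w p = (\<Sum>t | t \<in> ?T \<and> n t g = D g. F t p)"
  proof (rule homogeneous_part_group[where T = ?T and n = "\<lambda>t. n t g" and grp = grp and g = g])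
    show "finite ?T" using \<open>finite T\<close> by simp
    show "w p = (\<Sum>t\<in>?T. F t p)" for p
      using insert by simp
  qed (use insert.prems in auto)
  also have "{t. t \<in> ?T \<and> n t g = D g} = {t \<in> T. \<forall>g\<in>insert g G. n t g = D g}" by auto
  finally show ?case .
qed

lemma finite_exponents_mdeg:
  assumes "finite V"
  shows "finite ((\<lambda>\<alpha>. restrict \<alpha> V) ` {\<alpha>. \<forall>g\<in>grp ` V. mdeg V grp \<alpha> g = D})"
proof (rule finite_subset)
  show "(\<lambda>\<alpha>. restrict \<alpha> V) ` {\<alpha>. \<forall>g\<in>grp ` V. mdeg V grp \<alpha> g = D} \<subseteq> PiE V (\<lambda>_. {..D})"
  proof clarify
    fix \<alpha> assume \<alpha>: "\<forall>g\<in>grp ` V. mdeg V grp \<alpha> g = D"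
    have "\<alpha> v \<le> D" if "v \<in> V" for v
    proof -
      have "\<alpha> v \<le> mdeg V grp \<alpha> (grp v)"
        unfolding mdeg_def using assms that by (intro member_le_sum) auto
      with \<alpha> that show ?thesis by auto
    qed
    then show "restrict \<alpha> V \<in> PiE V (\<lambda>_. {..D})" by auto
  qed
  show "finite (PiE V (\<lambda>_. {..D}))" using assms by (simp add: finite_PiE)
qed

text \<open>At a common zero some whole group vanishes, so every product of one variable per group
  vanishes there and has a power in the ideal. A monomial of high degree in each group is divisible
  by such a power.\<close>

lemma unsolvable_imp_monomials_in_ideal:
  fixes grp :: "'v \<Rightarrow> 'g"
  assumes V: "finite V" and f: "\<And>e. e \<in> E \<Longrightarrow> f e \<in> polys V"
    and no: "\<And>p. nondegenerate V grp p \<Longrightarrow> \<exists>e\<in>E. f e p \<noteq> 0"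
  shows "\<exists>D. \<forall>\<alpha>. (\<forall>g\<in>grp ` V. mdeg V grp \<alpha> g = D) \<longrightarrow>
    mon V \<alpha> \<in> fs.span {mon V \<beta> * h | \<beta> h. h \<in> f ` E}"
proof -
  define G where "G = grp ` V"
  let ?I = "fs.span {mon V \<beta> * h | \<beta> h. h \<in> f ` E}"
  have I: "poly_submodule V ?I" using f by (intro poly_submodule_span) auto
  define Ch where "Ch = PiE G (\<lambda>g. {v \<in> V. grp v = g})"
  have finG: "finite G" using V by (simp add: G_def)
  have finCh: "finite Ch" unfolding Ch_def using V finG by (intro finite_PiE) auto
  define ex where "ex = (\<lambda>(c :: 'g \<Rightarrow> 'v) (d :: nat) v. if v \<in> c ` G then d else 0)"
  have inj: "inj_on c G" and sub: "c ` G \<subseteq> V" if "c \<in> Ch" for c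
    using that by (auto simp: Ch_def PiE_def Pi_def intro!: inj_on_inverseI[of _ grp])
  have ex_mon: "mon V (ex c d) p = (\<Prod>g\<in>G. p (c g) ^ d)" if "c \<in> Ch" for c d p
    unfolding ex_def mon_sum[OF V finG sub[OF that] inj[OF that]] ..
  have "\<exists>d. mon V (ex c 1) ^ d \<in> ?I" if c: "c \<in> Ch" for c
  proof (rule nullstellensatz[OF V])
    show "f ` E \<subseteq> polys V" using f by auto
    show "mon V (ex c 1) \<in> polys V" by (rule mon_in_polys)
    fix p assume p: "\<And>h. h \<in> f ` E \<Longrightarrow> h p = 0"
    then have "\<not> nondegenerate V grp p" using no by blast
    then obtain g where g: "g \<in> G" "\<And>v. v \<in> V \<Longrightarrow> grp v = g \<Longrightarrow> p v = 0"
      by (auto simp: nondegenerate_def G_def)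
    have "c g \<in> V" "grp (c g) = g" using c g(1) by (auto simp: Ch_def)
    then have "p (c g) = 0" using g by blast
    then show "mon V (ex c 1) p = 0"
      unfolding ex_mon[OF c] using g(1) finG by auto
  qed
  then have "\<forall>c\<in>Ch. \<exists>d. mon V (ex c 1) ^ d \<in> ?I" by blast
  from bchoice[OF this] obtain d where d: "\<And>c. c \<in> Ch \<Longrightarrow> mon V (ex c 1) ^ d c \<in> ?I" by blast
  define dm where "dm = Max (insert 0 (d ` Ch))"
  have dm: "d c \<le> dm" if "c \<in> Ch" for c using finCh that by (simp add: dm_def)
  \<comment> \<open>By the pigeonhole principle, degree above \<open>card V * dm\<close> in a group
    forces a variable with exponent at least \<open>dm\<close>.\<close>
  define D where "D = card V * dm + 1"
  have "mon V \<alpha> \<in> ?I" if \<alpha>: "\<forall>g\<in>grp ` V. mdeg V grp \<alpha> g = D" for \<alpha>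
  proof -
    have "\<exists>v\<in>V. grp v = g \<and> dm \<le> \<alpha> v" if g: "g \<in> G" for g
    proof (rule ccontr)
      assume "\<not> ?thesis"
      then have "\<alpha> v \<le> dm" if "v \<in> {v. v \<in> V \<and> grp v = g}" for v using that by force
      then have "mdeg V grp \<alpha> g \<le> card {v. v \<in> V \<and> grp v = g} * dm"
        unfolding mdeg_def using sum_bounded_above[of "{v. v \<in> V \<and> grp v = g}" \<alpha> dm] by simp
      also have "\<dots> \<le> card V * dm" using V by (intro mult_right_mono card_mono) auto
      also have "\<dots> < D" by (simp add: D_def)
      finally show False using \<alpha> g unfolding G_def by (metis less_irrefl)
    qed
    then obtain c0 where c0: "\<And>g. g \<in> G \<Longrightarrow> c0 g \<in> V \<and> grp (c0 g) = g \<and> dm \<le> \<alpha> (c0 g)" by metis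
    define c where "c = restrict c0 G"
    have c: "c \<in> Ch" using c0 by (auto simp: c_def Ch_def)
    define \<gamma> where "\<gamma> = (\<lambda>v. \<alpha> v - ex c (d c) v)"
    have "ex c (d c) v \<le> \<alpha> v" for v
      using c0 dm[OF c] by (auto simp: ex_def c_def intro: order_trans)
    then have "\<alpha> = \<gamma> + ex c (d c)" by (auto simp: \<gamma>_def fun_eq_iff)
    then have "mon V \<alpha> = mon V \<gamma> * mon V (ex c (d c))" by (simp only: mon_mult)
    also have "mon V (ex c (d c)) = mon V (ex c 1) ^ d c"
      unfolding mon_power by (rule mon_cong) (auto simp: ex_def)
    also have "mon V \<gamma> * \<dots> \<in> ?I"
      by (rule poly_submodule_mult[OF I mon_in_polys d[OF c]])
    finally show ?thesis .
  qed
  then show ?thesis by blast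
qed

text \<open>If \<open>f1\<close> had no nondegenerate zero, every monomial \<open>w\<close> of a large multidegree would be a
  combination \<open>\<Sum> q * f1\<close>. Replacing \<open>f1\<close> by \<open>f0\<close> in these combinations defines an endomorphism
  of the space of such monomials, and evaluation at a zero of \<open>f0 + s * f1\<close> is an eigenvector of its
  transpose for the eigenvalue \<open>- s\<close>.\<close>

theorem multihomogeneous_pencil:
  fixes f0 f1 :: "'e \<Rightarrow> ('v \<Rightarrow> complex) \<Rightarrow> complex"
  assumes V: "finite V"
    and f0: "\<And>e. e \<in> E \<Longrightarrow> f0 e \<in> multihomogeneous V grp (\<delta> e)"
    and f1: "\<And>e. e \<in> E \<Longrightarrow> f1 e \<in> multihomogeneous V grp (\<delta> e)"
    and S: "infinite S"
      "\<And>s. s \<in> S \<Longrightarrow> \<exists>p. nondegenerate V grp p \<and> (\<forall>e\<in>E. f0 e p + s * f1 e p = 0)"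
  shows "\<exists>p. nondegenerate V grp p \<and> (\<forall>e\<in>E. f1 e p = 0)"
proof (rule ccontr)
  assume no: "\<not> ?thesis"
  have sub: "multihomogeneous V grp \<epsilon> \<subseteq> polys V" for \<epsilon>
    unfolding multihomogeneous_def polys_def by (rule fs.span_mono) auto
  obtain D where D: "\<And>\<alpha>. (\<forall>g\<in>grp ` V. mdeg V grp \<alpha> g = D) \<Longrightarrow>
      mon V \<alpha> \<in> fs.span {mon V \<beta> * h | \<beta> h. h \<in> f1 ` E}"
    using unsolvable_imp_monomials_in_ideal[OF V, of E f1 grp] f1 sub no by blast
  define W where "W = (\<lambda>\<alpha>. restrict \<alpha> V) ` {\<alpha>. \<forall>g\<in>grp ` V. mdeg V grp \<alpha> g = D}"
  have W: "finite W" unfolding W_def by (rule finite_exponents_mdeg[OF V])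
  \<comment> \<open>The row \<open>b\<close> is chosen before \<open>s\<close> and \<open>p\<close>,
    so that one matrix serves the whole pencil.\<close>
  have "\<exists>b. \<forall>s p. (\<forall>e\<in>E. f0 e p + s * f1 e p = 0) \<longrightarrow> (\<Sum>w'\<in>W. b w' * mon V w' p) = - s * mon V w p"
    if "w \<in> W" for w
  proof -
    have wD: "\<forall>g\<in>grp ` V. mdeg V grp w g = D"
      using that by (auto simp: W_def mdeg_restrict)
    obtain t r where t: "finite t" "t \<subseteq> {mon V \<beta> * h | \<beta> h. h \<in> f1 ` E}"
      and wt: "mon V w = (\<Sum>a\<in>t. fscale (r a) a)"
      using D[OF wD] unfolding fs.span_explicit by auto
    have "\<forall>a\<in>t. \<exists>be. snd be \<in> E \<and> a = mon V (fst be) * f1 (snd be)"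
      using t(2) by fastforce
    from bchoice[OF this] obtain be
      where be: "\<And>a. a \<in> t \<Longrightarrow> snd (be a) \<in> E" "\<And>a. a \<in> t \<Longrightarrow> a = mon V (fst (be a)) * f1 (snd (be a))"
      by blast
    define n where "n = (\<lambda>a g. mdeg V grp (fst (be a)) g + \<delta> (snd (be a)) g)"
    \<comment> \<open>Only summands of multidegree \<open>D\<close> are kept. Since
      \<open>f0\<close> and \<open>f1\<close> have equal multidegrees, exchanging them in these
      summands stays in the span of the monomials in \<open>W\<close>.\<close>
    define t' where "t' = {a \<in> t. \<forall>g\<in>grp ` V. n a g = D}"
    have part: "mon V w p = (\<Sum>a\<in>t'. fscale (r a) a p)" for p
      unfolding t'_def
    proof (rule homogeneous_part[OF t(1), where G = "grp ` V" and n = n and D = "\<lambda>_. D" and grp = grp])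
      show "finite (grp ` V)" using V by simp
      show "mon V w p = (\<Sum>a\<in>t. fscale (r a) a p)" for p
        unfolding wt sum_fun_apply ..
      show "mon V w (scale_group grp g c p) = c ^ D * mon V w p" if "g \<in> grp ` V" for g c p
        using mon_scale_group[OF V, of w grp g c p] wD that by simp
      fix a g c p assume a: "a \<in> t" and g: "g \<in> grp ` V"
      have "a \<in> multihomogeneous V grp (n a)"
        by (rule ssubst[OF be(2)[OF a], where P = "\<lambda>x. x \<in> multihomogeneous V grp (n a)"],
            rule mon_mult_multihomogeneous[OF f1[OF be(1)[OF a]]]) (simp add: n_def)
      then have "a (scale_group grp g c p) = c ^ n a g * a p"
        by (rule multihomogeneous_scale_group[OF V g])
      then show "fscale (r a) a (scale_group grp g c p) = c ^ n a g * fscale (r a) a p"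
        by (simp add: fscale_def)
    qed
    define B where "B = (\<Sum>a\<in>t'. fscale (r a) (mon V (fst (be a)) * f0 (snd (be a))))"
    have "B \<in> multihomogeneous V grp (\<lambda>_. D)"
      unfolding B_def
    proof -
      have "mon V (fst (be a)) * f0 (snd (be a)) \<in> multihomogeneous V grp (\<lambda>_. D)" if "a \<in> t'" for a
        using that by (intro mon_mult_multihomogeneous[OF f0] be) (auto simp: t'_def n_def)
      then show "(\<Sum>a\<in>t'. fscale (r a) (mon V (fst (be a)) * f0 (snd (be a)))) \<in> multihomogeneous V grp (\<lambda>_. D)"
        unfolding multihomogeneous_def by (intro fs.span_sum fs.span_scale)
    qed
    then obtain U b where U: "U \<subseteq> W" "B = (\<lambda>p. \<Sum>\<alpha>\<in>U. b \<alpha> * mon V \<alpha> p)"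
      unfolding multihomogeneous_def W_def using span_mon_finite_support by blast
    define b' where "b' = (\<lambda>\<alpha>. if \<alpha> \<in> U then b \<alpha> else 0)"
    have B: "B p = (\<Sum>\<alpha>\<in>W. b' \<alpha> * mon V \<alpha> p)" for p
      unfolding U(2) b'_def using W U(1) by (intro sum.mono_neutral_cong_left) auto
    have "(\<Sum>\<alpha>\<in>W. b' \<alpha> * mon V \<alpha> p) = - s * mon V w p" if z: "\<forall>e\<in>E. f0 e p + s * f1 e p = 0" for s p
    proof -
      have "fscale (r a) (mon V (fst (be a)) * f0 (snd (be a))) p = - s * fscale (r a) a p" if "a \<in> t'" for a
      proof -
        have a: "a \<in> t" using that by (simp add: t'_def)
        have "f0 (snd (be a)) p = - s * f1 (snd (be a)) p"
          using z be(1)[OF a] by (simp add: eq_neg_iff_add_eq_0)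
        moreover have "a p = mon V (fst (be a)) p * f1 (snd (be a)) p"
          using fun_cong[OF be(2)[OF a], of p] by simp
        ultimately show ?thesis by (simp add: fscale_def)
      qed
      then have "B p = (\<Sum>a\<in>t'. - s * fscale (r a) a p)"
        unfolding B_def sum_fun_apply by (rule sum.cong[OF refl])
      also have "\<dots> = - s * mon V w p" unfolding part sum_distrib_left ..
      finally show ?thesis by (simp add: B)
    qed
    then show ?thesis by blast
  qed
  then have "\<forall>w\<in>W. \<exists>b. \<forall>s p. (\<forall>e\<in>E. f0 e p + s * f1 e p = 0) \<longrightarrow> (\<Sum>w'\<in>W. b w' * mon V w' p) = - s * mon V w p"
    by blast
  from bchoice[OF this] obtain b where b: "\<And>w s p. w \<in> W \<Longrightarrow> \<forall>e\<in>E. f0 e p + s * f1 e p = 0 \<Longrightarrow>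
      (\<Sum>w'\<in>W. b w w' * mon V w' p) = - s * mon V w p" by blast
  have "finite (uminus ` S)"
  proof (rule finite_eigenvalues[OF W])
    fix l assume "l \<in> uminus ` S"
    then obtain s where s: "s \<in> S" "l = - s" by blast
    obtain p where p: "nondegenerate V grp p" "\<forall>e\<in>E. f0 e p + s * f1 e p = 0" using S(2)[OF s(1)] by blast
    \<comment> \<open>Nondegeneracy makes the evaluation vector nonzero: the product of the
      \<open>D\<close>-th powers of one nonvanishing variable per group is among the monomials of
      \<open>W\<close>.\<close>
    have "\<forall>g\<in>grp ` V. \<exists>v. v \<in> V \<and> grp v = g \<and> p v \<noteq> 0"
      using p(1) unfolding nondegenerate_def by blast
    from bchoice[OF this] obtain c
      where c: "\<And>g. g \<in> grp ` V \<Longrightarrow> c g \<in> V \<and> grp (c g) = g \<and> p (c g) \<noteq> 0" by blast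
    define w where "w = restrict (\<lambda>v. if v \<in> c ` grp ` V then D else 0) V"
    have "mdeg V grp (\<lambda>v. if v \<in> c ` grp ` V then D else 0) g = D" if g: "g \<in> grp ` V" for g
    proof -
      have "mdeg V grp (\<lambda>v. if v \<in> c ` grp ` V then D else 0) g =
         (\<Sum>v | v \<in> V \<and> grp v = g. if v = c g then D else 0)"
        unfolding mdeg_def
      proof (intro sum.cong refl if_cong)
        fix x assume x: "x \<in> {v. v \<in> V \<and> grp v = g}"
        show "x \<in> c ` grp ` V \<longleftrightarrow> x = c g"
        proof
          assume "x \<in> c ` grp ` V"
          then obtain g' where "g' \<in> grp ` V" "x = c g'" by blast
          with c[of g'] x show "x = c g" by simp
        qed (use g in blast)
      qed
      also have "\<dots> = D" using V c[OF g] by simp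
      finally show ?thesis .
    qed
    then have "w \<in> W" unfolding w_def W_def by blast
    moreover have "mon V w p \<noteq> 0"
      unfolding w_def mon_restrict mon_def using V c by (auto)
    ultimately show "\<exists>e. (\<exists>x\<in>W. e x \<noteq> 0) \<and> (\<forall>x\<in>W. (\<Sum>y\<in>W. b x y * e y) = l * e x)"
      using b[OF _ p(2)] s(2) by (intro exI[of _ "\<lambda>w. mon V w p"]) auto
  qed
  then show False using S(1) by (simp add: finite_image_iff)
qed

section \<open>Solvability\<close>

text \<open>Banach iteration of \<open>- s * Q z\<close> from 0 on the unit polydisc, with distances
  measured by the sum over the coordinates in \<open>E\<close>.\<close>

lemma contraction_fixed_point:
  fixes Q :: "('e \<Rightarrow> complex) \<Rightarrow> 'e \<Rightarrow> complex"
  assumes E: "finite E" and L: "0 \<le> L" and C: "0 \<le> C"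
    and bnd: "\<And>z e. e \<in> E \<Longrightarrow> (\<And>e. norm (z e) \<le> 1) \<Longrightarrow> norm (Q z e) \<le> C"
    and lip: "\<And>z z' e. e \<in> E \<Longrightarrow> (\<And>e. norm (z e) \<le> 1) \<Longrightarrow> (\<And>e. norm (z' e) \<le> 1) \<Longrightarrow>
      norm (Q z e - Q z' e) \<le> L * (\<Sum>e\<in>E. norm (z e - z' e))"
  shows "\<exists>\<epsilon>>0. \<forall>s. norm s < \<epsilon> \<longrightarrow> (\<exists>z. \<forall>e\<in>E. z e + s * Q z e = 0)"
proof -
  \<comment> \<open>\<open>C\<close> keeps the iterates in the polydisc;
    \<open>2 * L * card E\<close> gives contraction factor 1/2, with \<open>card E\<close> coming
    from summing the coordinate bounds; the 1 keeps the denominator positive.\<close>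
  define \<epsilon> where "\<epsilon> = 1 / (1 + C + 2 * L * card E)"
  have pos: "0 < 1 + C + 2 * L * card E" using L C by (smt (verit) mult_nonneg_nonneg of_nat_0_le_iff)
  have "\<exists>z. \<forall>e\<in>E. z e + s * Q z e = 0" if s: "norm s < \<epsilon>" for s
  proof -
    have s1: "norm s * (1 + C + 2 * L * card E) \<le> 1"
      using s pos by (simp add: \<epsilon>_def pos_less_divide_eq less_imp_le)
    have "norm s * C \<le> norm s * (1 + C + 2 * L * card E)"
      and "norm s * (2 * L * card E) \<le> norm s * (1 + C + 2 * L * card E)"
      using L C by (auto intro!: mult_left_mono)
    with s1 have sC: "norm s * C \<le> 1" and sL: "norm s * L * card E \<le> 1 / 2" by (auto simp: mult_ac)
    \<comment> \<open>Coordinates outside \<open>E\<close> stay 0, because the bounds on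
      \<open>Q\<close> presuppose norm at most 1 at every index.\<close>
    define T where "T = (\<lambda>z e. if e \<in> E then - (s * Q z e) else 0)"
    define x where "x = (\<lambda>n. (T ^^ n) (\<lambda>_. 0))"
    have x_Suc: "x (Suc n) = T (x n)" for n by (simp add: x_def)
    have x_le: "norm (x n e) \<le> 1" for n e
    proof (induction n arbitrary: e)
      case 0
      show ?case by (simp add: x_def)
    next
      case (Suc n)
      have "norm s * norm (Q (x n) e) \<le> 1" if "e \<in> E"
        using bnd[OF that Suc] sC by (meson mult_left_mono norm_ge_zero order_trans)
      then show ?case by (simp add: x_Suc T_def norm_mult)
    qed
    define d where "d = (\<lambda>n. \<Sum>e\<in>E. norm (x (Suc n) e - x n e))"
    have d_nn: "0 \<le> d n" for n by (simp add: d_def sum_nonneg)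
    have d_Suc: "d (Suc n) \<le> d n / 2" for n
    proof -
      have "norm (x (Suc (Suc n)) e - x (Suc n) e) \<le> norm s * L * d n" if e: "e \<in> E" for e
      proof -
        have "x (Suc (Suc n)) e - x (Suc n) e = - (s * (Q (x (Suc n)) e - Q (x n) e))"
          using e by (simp add: x_Suc T_def algebra_simps)
        then have "norm (x (Suc (Suc n)) e - x (Suc n) e) = norm s * norm (Q (x (Suc n)) e - Q (x n) e)"
          by (simp add: norm_mult)
        also have "\<dots> \<le> norm s * (L * d n)"
          unfolding d_def by (intro mult_left_mono lip[OF e x_le x_le]) auto
        finally show ?thesis by (simp add: mult.assoc)
      qed
      then have "d (Suc n) \<le> card E * (norm s * L * d n)"
        using sum_bounded_above[of E "\<lambda>e. norm (x (Suc (Suc n)) e - x (Suc n) e)" "norm s * L * d n"]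
        by (simp add: d_def)
      also have "\<dots> = (norm s * L * card E) * d n" by simp
      also have "\<dots> \<le> 1 / 2 * d n" using sL d_nn by (rule mult_right_mono)
      finally show ?thesis by simp
    qed
    have d_le: "d n \<le> d 0 * (1 / 2) ^ n" for n
    proof (induction n)
      case (Suc n)
      then show ?case using d_Suc[of n] by simp
    qed simp
    have "convergent (\<lambda>n. x n e)" if e: "e \<in> E" for e
    proof -
      have "norm (x (Suc n) e - x n e) \<le> d 0 * (1 / 2) ^ n" for n
        using d_le[of n] member_le_sum[of e E "\<lambda>e. norm (x (Suc n) e - x n e)"] E e by (simp add: d_def)
      then have "summable (\<lambda>n. x (Suc n) e - x n e)"
        by (rule summable_comparison_test'[rotated]) (simp add: summable_mult summable_geometric)
      then have "convergent (\<lambda>n. \<Sum>k<n. x (Suc k) e - x k e)"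
        by (simp add: summable_iff_convergent)
      then have "convergent (\<lambda>n. x n e - x 0 e)" by (simp only: sum_lessThan_telescope[of "\<lambda>n. x n e"])
      then show ?thesis using convergent_diff_const_right_iff by blast
    qed
    then obtain y where y: "\<And>e. e \<in> E \<Longrightarrow> (\<lambda>n. x n e) \<longlonglongrightarrow> y e" unfolding convergent_def by metis
    define z where "z = (\<lambda>e. if e \<in> E then y e else 0)"
    have z: "(\<lambda>n. x n e) \<longlonglongrightarrow> z e" if "e \<in> E" for e using y[OF that] that by (simp add: z_def)
    have z_le: "norm (z e) \<le> 1" for e
    proof (cases "e \<in> E")
      case True
      have "(\<lambda>n. norm (x n e)) \<longlonglongrightarrow> norm (z e)" using z[OF True] by (rule tendsto_norm)
      then show ?thesis using x_le by (intro LIMSEQ_le_const2) auto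
    qed (simp add: z_def)
    have "z e + s * Q z e = 0" if e: "e \<in> E" for e
    proof -
      have "(\<lambda>n. L * (\<Sum>e\<in>E. norm (x n e - z e))) \<longlonglongrightarrow> L * (\<Sum>e\<in>E. norm (z e - z e))"
        by (intro tendsto_intros z)
      then have lim: "(\<lambda>n. L * (\<Sum>e\<in>E. norm (x n e - z e))) \<longlonglongrightarrow> 0" by simp
      have le: "norm (Q (x n) e - Q z e) \<le> L * (\<Sum>e\<in>E. norm (x n e - z e))" for n
        by (rule lip[OF e x_le z_le])
      have "(\<lambda>n. Q (x n) e - Q z e) \<longlonglongrightarrow> 0"
        by (rule Lim_null_comparison[OF always_eventually[OF allI[OF le]] lim])
      then have "(\<lambda>n. Q (x n) e) \<longlonglongrightarrow> Q z e" by (rule LIM_zero_cancel)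
      then have "(\<lambda>n. x (Suc n) e) \<longlonglongrightarrow> - (s * Q z e)"
        unfolding x_Suc T_def using e by (auto intro!: tendsto_intros)
      moreover have "(\<lambda>n. x (Suc n) e) \<longlonglongrightarrow> z e" using z[OF e] by (rule LIMSEQ_Suc)
      ultimately have "- (s * Q z e) = z e" by (rule LIMSEQ_unique)
      then show ?thesis by (metis add.left_inverse)
    qed
    then show ?thesis by blast
  qed
  moreover have "\<epsilon> > 0" using pos by (simp add: \<epsilon>_def)
  ultimately show ?thesis by blast
qed

section \<open>Alignment equations as multihomogeneous forms\<close>

text \<open>The variable \<open>(False, i, a)\<close> is the conjugate of entry \<open>a\<close> of the receive vector of user \<open>i\<close>,
  and \<open>(True, j, b)\<close> is entry \<open>b\<close> of the transmit vector of user \<open>j\<close>.\<close>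

definition ia_vars :: "nat \<Rightarrow> (nat \<Rightarrow> nat) \<Rightarrow> (nat \<Rightarrow> nat) \<Rightarrow> (bool \<times> nat \<times> nat) set" where
  "ia_vars K N M = {(s, i, a). i \<in> {1..K} \<and> a < (if s then M i else N i)}"

definition ia_group :: "bool \<times> nat \<times> nat \<Rightarrow> bool \<times> nat" where
  "ia_group v = (fst v, fst (snd v))"

definition ia_form ::
  "(nat \<Rightarrow> nat) \<Rightarrow> (nat \<Rightarrow> nat) \<Rightarrow> (nat \<times> nat \<times> nat \<times> nat \<Rightarrow> complex) \<Rightarrow> nat \<times> nat \<Rightarrow>
    (bool \<times> nat \<times> nat \<Rightarrow> complex) \<Rightarrow> complex" where
  "ia_form N M H e p = (\<Sum>a<N (fst e). \<Sum>b<M (snd e).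
     p (False, fst e, a) * H (fst e, snd e, a, b) * p (True, snd e, b))"

definition ia_links :: "nat \<Rightarrow> (nat \<times> nat) set" where
  "ia_links K = {(i, j). i \<in> {1..K} \<and> j \<in> {1..K} \<and> i \<noteq> j}"

lemma finite_ia_links: "finite (ia_links K)"
  by (rule finite_subset[of _ "{1..K} \<times> {1..K}"]) (auto simp: ia_links_def)

lemma finite_ia_vars: "finite (ia_vars K N M)"
proof -
  have "ia_vars K N M \<subseteq> (\<Union>i\<in>{1..K}. UNIV \<times> {i} \<times> {..<M i + N i})"
    by (auto simp: ia_vars_def split: if_splits)
  then show ?thesis by (rule finite_subset) auto
qed

text \<open>The multidegree depends on the link but not on \<open>H\<close>, which is what permits
  the forms of two channels to be exchanged.\<close>

lemma ia_form_multihomogeneous: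
  assumes "e \<in> ia_links K"
  shows "ia_form N M H e \<in> multihomogeneous (ia_vars K N M) ia_group
    (\<lambda>g. of_bool (g = (False, fst e)) + of_bool (g = (True, snd e)))"
proof -
  obtain i j where e: "e = (i, j)" and ij: "i \<in> {1..K}" "j \<in> {1..K}"
    using assms by (auto simp: ia_links_def)
  let ?V = "ia_vars K N M"
  define ex :: "bool \<times> nat \<times> nat \<Rightarrow> bool \<times> nat \<times> nat \<Rightarrow> nat" where "ex = (\<lambda>v w. if w = v then 1 else 0)"
  have deg: "mdeg ?V ia_group (ex v) g = of_bool (g = ia_group v)" if "v \<in> ?V" for v g
    using that finite_ia_vars[of K N M] by (auto simp: mdeg_def ex_def)
  have "ia_form N M H e = (\<Sum>a<N i. \<Sum>b<M j.
      fscale (H (i, j, a, b)) (mon ?V (ex (False, i, a) + ex (True, j, b))))"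
  proof
    fix p
    have coord: "mon ?V (ex v) p = p v" if "v \<in> ?V" for v
      using fun_cong[OF coord_eq_mon[OF finite_ia_vars that], of p] by (simp add: ex_def)
    have "ia_form N M H e p = (\<Sum>a<N i. \<Sum>b<M j.
      fscale (H (i, j, a, b)) (mon ?V (ex (False, i, a)) * mon ?V (ex (True, j, b))) p)"
      unfolding ia_form_def e fst_conv snd_conv
    proof (intro sum.cong refl)
      fix a b assume "a \<in> {..<N i}" "b \<in> {..<M j}"
      then have "(False, i, a) \<in> ?V" "(True, j, b) \<in> ?V" using ij by (auto simp: ia_vars_def)
      then show "p (False, i, a) * H (i, j, a, b) * p (True, j, b) =
          fscale (H (i, j, a, b)) (mon ?V (ex (False, i, a)) * mon ?V (ex (True, j, b))) p"
        by (simp add: coord fscale_def)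
    qed
    then show "ia_form N M H e p = (\<Sum>a<N i. \<Sum>b<M j.
      fscale (H (i, j, a, b)) (mon ?V (ex (False, i, a) + ex (True, j, b)))) p"
      unfolding sum_fun_apply mon_mult .
  qed
  also have "\<dots> \<in> multihomogeneous ?V ia_group
    (\<lambda>g. of_bool (g = (False, fst e)) + of_bool (g = (True, snd e)))"
    unfolding multihomogeneous_def
  proof (intro fs.span_sum fs.span_scale fs.span_base imageI CollectI ballI)
    fix a b g assume "a \<in> {..<N i}" "b \<in> {..<M j}"
    then have "(False, i, a) \<in> ?V" "(True, j, b) \<in> ?V" using ij by (auto simp: ia_vars_def)
    then show "mdeg ?V ia_group (ex (False, i, a) + ex (True, j, b)) g =
       of_bool (g = (False, fst e)) + of_bool (g = (True, snd e))"
      unfolding mdeg_add by (simp add: deg ia_group_def e)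
  qed
  finally show ?thesis .
qed

lemma IA_solvableI:
  assumes pos: "\<forall>i\<in>{1..K}. N i \<ge> 1 \<and> M i \<ge> 1"
    and p: "nondegenerate (ia_vars K N M) ia_group p" "\<forall>e\<in>ia_links K. ia_form N M H e p = 0"
  shows "IA_solvable K N M H"
  unfolding IA_solvable_def
proof (rule exI[of _ "\<lambda>j b. p (True, j, b)"], rule exI[of _ "\<lambda>i a. cnj (p (False, i, a))"],
    intro conjI ballI impI)
  let ?t = "\<lambda>j b. p (True, j, b)" and ?g = "\<lambda>i a. cnj (p (False, i, a))"
  have nd: "\<exists>a < (if s then M i else N i). p (s, i, a) \<noteq> 0" if i: "i \<in> {1..K}" for s i
  proof -
    have "(s, i, 0) \<in> ia_vars K N M" using pos i by (force simp: ia_vars_def)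
    then have "(s, i) \<in> ia_group ` ia_vars K N M" by (force simp: ia_group_def)
    then obtain v where "v \<in> ia_vars K N M" "ia_group v = (s, i)" "p v \<noteq> 0"
      using p(1) unfolding nondegenerate_def by blast
    then show ?thesis by (cases v) (auto simp: ia_vars_def ia_group_def)
  qed
  show "\<exists>b<M j. ?t j b \<noteq> 0" if "j \<in> {1..K}" for j using nd[OF that, of True] by simp
  show "\<exists>a<N i. ?g i a \<noteq> 0" if "i \<in> {1..K}" for i using nd[OF that, of False] by simp
  fix i j assume "i \<in> {1..K}" "j \<in> {1..K}" "i \<noteq> j"
  then have "ia_form N M H (i, j) p = 0" using p(2) by (auto simp: ia_links_def)
  then show "(\<Sum>a<N i. \<Sum>b<M j. cnj (?g i a) * H (i, j, a, b) * ?t j b) = 0"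
    by (simp add: ia_form_def)
qed

text \<open>Index 0 is left out because that entry is normalised to 1; what remains are the
  \<open>N i - 1\<close> and \<open>M j - 1\<close> unknowns counted by
  \<open>N_Var\<close>.\<close>

definition free_vars :: "(nat \<Rightarrow> nat) \<Rightarrow> (nat \<Rightarrow> nat) \<Rightarrow> nat \<times> nat \<Rightarrow> (bool \<times> nat \<times> nat) set" where
  "free_vars N M e = (\<lambda>a. (False, fst e, a)) ` {1..<N (fst e)} \<union> (\<lambda>b. (True, snd e, b)) ` {1..<M (snd e)}"

text \<open>Enlarging a set of links to all links between its receivers and its transmitters adds no
  new variables. Hall's condition therefore reduces to the sets of links given by pairs
  \<open>(SR, ST)\<close>.\<close>

lemma exists_matching:
  assumes cond: "\<forall>SR ST. SR \<subseteq> {1..K} \<longrightarrow> ST \<subseteq> {1..K} \<longrightarrow> N_Var N M SR ST \<ge> N_Eq SR ST"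
  shows "\<exists>f. inj_on f (ia_links K) \<and> (\<forall>e\<in>ia_links K. f e \<in> free_vars N M e)"
proof (rule hall_marriage)
  show "finite (ia_links K)" by (rule finite_ia_links)
  show "finite (free_vars N M e)" for e by (simp add: free_vars_def)
  fix J assume J: "J \<subseteq> ia_links K"
  let ?R = "fst ` J" and ?T = "snd ` J"
  have fin: "finite J" using J finite_ia_links finite_subset by blast
  have sub: "?R \<subseteq> {1..K}" "?T \<subseteq> {1..K}" using J by (auto simp: ia_links_def)
  have "card J \<le> N_Eq ?R ?T"
    unfolding N_Eq_def
  proof (rule card_mono)
    show "finite {(j, k). j \<in> ?R \<and> k \<in> ?T \<and> j \<noteq> k}"
      by (rule finite_subset[of _ "?R \<times> ?T"]) (use fin in auto)
    show "J \<subseteq> {(j, k). j \<in> ?R \<and> k \<in> ?T \<and> j \<noteq> k}" using J by (force simp: ia_links_def)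
  qed
  also have "\<dots> \<le> N_Var N M ?R ?T" using cond sub by blast
  also have "\<dots> = card ((\<lambda>v. (False, v)) ` Sigma ?R (\<lambda>i. {1..<N i}) \<union> (\<lambda>v. (True, v)) ` Sigma ?T (\<lambda>j. {1..<M j}))"
    using fin by (subst card_Un_disjoint) (auto simp: card_image inj_on_def N_Var_def)
  also have "(\<lambda>v. (False, v)) ` Sigma ?R (\<lambda>i. {1..<N i}) \<union> (\<lambda>v. (True, v)) ` Sigma ?T (\<lambda>j. {1..<M j})
      = \<Union>(free_vars N M ` J)"
    by (force simp: free_vars_def)
  finally show "card J \<le> card (\<Union>(free_vars N M ` J))" .
qed

text \<open>For the channel whose form for every link is the variable matched with that link, the
  perturbed system in the chart where the entries with index \<open>0\<close> equal \<open>1\<close> is a fixed point problem.\<close>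

lemma IA_solvable_if_matching:
  assumes pos: "\<forall>i\<in>{1..K}. N i \<ge> 1 \<and> M i \<ge> 1"
    and inj: "inj_on f (ia_links K)" and f: "\<And>e. e \<in> ia_links K \<Longrightarrow> f e \<in> free_vars N M e"
  shows "IA_solvable K N M H"
proof -
  let ?E = "ia_links K" and ?V = "ia_vars K N M"
  \<comment> \<open>The matched variable belongs to one end of the link. Its product with the entry
    of index 0 at the other end is bilinear and equals the variable in the chart.\<close>
  define H0 :: "nat \<times> nat \<times> nat \<times> nat \<Rightarrow> complex" where
    "H0 = (\<lambda>(i, j, a, b). of_bool (b = 0 \<and> f (i, j) = (False, i, a) \<or> a = 0 \<and> f (i, j) = (True, j, b)))"
  \<comment> \<open>Unmatched variables are frozen at 0, which leaves one unknown per
    equation.\<close>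
  define pt where "pt = (\<lambda>(z :: nat \<times> nat \<Rightarrow> complex) v. if snd (snd v) = 0 then 1
     else if v \<in> f ` ?E then z (inv_into ?E f v) else 0)"
  have pt_0: "pt z (s, i, 0) = 1" for z s i by (simp add: pt_def)
  have pt_f: "pt z (f e) = z e" if "e \<in> ?E" for z e
    using f[OF that] that inj by (auto simp: pt_def free_vars_def)
  have H0: "ia_form N M H0 e (pt z) = z e" if e: "e \<in> ?E" for e z
  proof -
    obtain i j where ij: "e = (i, j)" by force
    have Np: "0 < N i" "0 < M j" using e pos by (auto simp: ij ia_links_def Suc_le_eq)
    have "f e \<in> free_vars N M e" using f[OF e] .
    then consider a where "f e = (False, i, a)" "1 \<le> a" "a < N i" | b where "f e = (True, j, b)" "1 \<le> b" "b < M j"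
      by (auto simp: free_vars_def ij)
    then show ?thesis
    proof cases
      case 1
      have "ia_form N M H0 e (pt z) = (\<Sum>a'<N i. \<Sum>b'<M j. if b' = 0 then if a' = a then pt z (f e) else 0 else 0)"
        unfolding ia_form_def ij using 1 ij
        by (intro sum.cong) (auto simp: H0_def pt_0)
      also have "\<dots> = z e" using 1 Np pt_f[OF e] by simp
      finally show ?thesis .
    next
      case 2
      have "ia_form N M H0 e (pt z) = (\<Sum>a'<N i. \<Sum>b'<M j. if b' = b then if a' = 0 then pt z (f e) else 0 else 0)"
        unfolding ia_form_def ij using 2 ij
        by (intro sum.cong) (auto simp: H0_def pt_0)
      also have "\<dots> = z e" using 2 Np pt_f[OF e] by simp
      finally show ?thesis .
    qed
  qed
  have pt_le: "norm (pt z v) \<le> 1" if "\<And>e. norm (z e) \<le> 1" for z v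
    using that by (simp add: pt_def)
  have pt_lip: "norm (pt z v - pt z' v) \<le> (\<Sum>e\<in>?E. norm (z e - z' e))" for z z' v
  proof (cases "snd (snd v) \<noteq> 0 \<and> v \<in> f ` ?E")
    case True
    then obtain e where "e \<in> ?E" "v = f e" by blast
    then show ?thesis
      using pt_f member_le_sum[of e ?E "\<lambda>e. norm (z e - z' e)"] finite_ia_links by simp
  qed (auto simp: pt_def sum_nonneg)
  define C where "C = (\<Sum>e\<in>?E. \<Sum>a<N (fst e). \<Sum>b<M (snd e). norm (H (fst e, snd e, a, b)))"
  have C0: "0 \<le> C" unfolding C_def by (intro sum_nonneg) auto
  have Ce: "(\<Sum>a<N (fst e). \<Sum>b<M (snd e). norm (H (fst e, snd e, a, b))) \<le> C" if "e \<in> ?E" for e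
    unfolding C_def using that finite_ia_links
    by (intro member_le_sum[where f = "\<lambda>e. \<Sum>a<N (fst e). \<Sum>b<M (snd e). norm (H (fst e, snd e, a, b))"])
      (auto intro!: sum_nonneg)
  have "\<exists>\<epsilon>>0. \<forall>s. norm s < \<epsilon> \<longrightarrow> (\<exists>z. \<forall>e\<in>?E. z e + s * ia_form N M H e (pt z) = 0)"
  \<comment> \<open>A difference of products of two entries splits into two terms, one per entry,
    each bounded by the sum distance; hence the factor 2.\<close>
  proof (rule contraction_fixed_point[where C = C and L = "2 * C"])
    show "finite ?E" by (rule finite_ia_links)
    show "0 \<le> 2 * C" "0 \<le> C" using C0 by auto
    fix z z' :: "nat \<times> nat \<Rightarrow> complex" and e assume e: "e \<in> ?E" and z: "\<And>e. norm (z e) \<le> 1"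
    have "norm (ia_form N M H e (pt z)) \<le> (\<Sum>a<N (fst e). \<Sum>b<M (snd e). norm (H (fst e, snd e, a, b)))"
      unfolding ia_form_def
    proof (intro sum_norm_le)
      fix a b
      show "norm (pt z (False, fst e, a) * H (fst e, snd e, a, b) * pt z (True, snd e, b)) \<le> norm (H (fst e, snd e, a, b))"
        (is "norm (?x * ?h * ?y) \<le> _")
      proof -
        have "norm ?x \<le> 1" "norm ?y \<le> 1" by (rule pt_le[OF z])+
        then have "norm ?x * norm ?y * norm ?h \<le> 1 * 1 * norm ?h"
          by (intro mult_mono) auto
        then show ?thesis by (simp add: norm_mult mult_ac)
      qed
    qed
    also note Ce[OF e]
    finally show "norm (ia_form N M H e (pt z)) \<le> C" .
    assume z': "\<And>e. norm (z' e) \<le> 1"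
    let ?S = "\<Sum>e\<in>?E. norm (z e - z' e)"
    have "norm (ia_form N M H e (pt z) - ia_form N M H e (pt z')) \<le>
       (\<Sum>a<N (fst e). \<Sum>b<M (snd e). norm (H (fst e, snd e, a, b)) * (2 * ?S))"
      unfolding ia_form_def sum_subtractf[symmetric]
    proof (intro sum_norm_le)
      fix a b
      let ?x = "pt z (False, fst e, a)" and ?y = "pt z (True, snd e, b)" and ?h = "H (fst e, snd e, a, b)"
        and ?x' = "pt z' (False, fst e, a)" and ?y' = "pt z' (True, snd e, b)"
      have "?x * ?h * ?y - ?x' * ?h * ?y' = ?h * ((?x - ?x') * ?y + ?x' * (?y - ?y'))"
        by (simp add: algebra_simps)
      then have "norm (?x * ?h * ?y - ?x' * ?h * ?y') = norm ?h * norm ((?x - ?x') * ?y + ?x' * (?y - ?y'))"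
        by (simp add: norm_mult)
      also have "norm ((?x - ?x') * ?y + ?x' * (?y - ?y')) \<le> norm (?x - ?x') * norm ?y + norm ?x' * norm (?y - ?y')"
        unfolding norm_mult[symmetric] by (rule norm_triangle_ineq)
      also have "\<dots> \<le> ?S * 1 + 1 * ?S"
        by (intro add_mono mult_mono pt_lip pt_le[OF z] pt_le[OF z'] sum_nonneg norm_ge_zero zero_le_one)
      finally show "norm (?x * ?h * ?y - ?x' * ?h * ?y') \<le> norm ?h * (2 * ?S)"
        by (simp add: mult_left_mono)
    qed
    also have "\<dots> = (\<Sum>a<N (fst e). \<Sum>b<M (snd e). norm (H (fst e, snd e, a, b))) * (2 * ?S)"
      by (simp add: sum_distrib_right)
    also have "\<dots> \<le> C * (2 * ?S)" using Ce[OF e] by (intro mult_right_mono) (auto intro: sum_nonneg)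
    finally show "norm (ia_form N M H e (pt z) - ia_form N M H e (pt z')) \<le> 2 * C * ?S" by simp
  qed
  then obtain \<epsilon> where \<epsilon>: "\<epsilon> > 0"
    "\<And>s. norm s < \<epsilon> \<Longrightarrow> \<exists>z. \<forall>e\<in>?E. z e + s * ia_form N M H e (pt z) = 0" by blast
  have "\<exists>p. nondegenerate ?V ia_group p \<and> (\<forall>e\<in>?E. ia_form N M H e p = 0)"
  proof (rule multihomogeneous_pencil[where ?f0.0 = "ia_form N M H0" and S = "ball 0 \<epsilon>"])
    show "finite ?V" by (rule finite_ia_vars)
    show "ia_form N M H0 e \<in> multihomogeneous ?V ia_group
          (\<lambda>g. of_bool (g = (False, fst e)) + of_bool (g = (True, snd e)))"
      "ia_form N M H e \<in> multihomogeneous ?V ia_group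
          (\<lambda>g. of_bool (g = (False, fst e)) + of_bool (g = (True, snd e)))" if "e \<in> ?E" for e
      by (rule ia_form_multihomogeneous[OF that])+
    show "infinite (ball (0 :: complex) \<epsilon>)"
      using \<epsilon>(1) uncountable_ball[of \<epsilon> 0] countable_finite by blast
    fix s :: complex assume "s \<in> ball 0 \<epsilon>"
    then obtain z where "\<forall>e\<in>?E. z e + s * ia_form N M H e (pt z) = 0" using \<epsilon>(2)[of s] by auto
    moreover have "nondegenerate ?V ia_group (pt z)"
      unfolding nondegenerate_def
    proof
      fix g assume "g \<in> ia_group ` ?V"
      then obtain s i a where g: "g = ia_group (s, i, a)" "(s, i, a) \<in> ?V" by auto
      then have "(s, i, 0) \<in> ?V" using pos by (force simp: ia_vars_def)
      then show "\<exists>v\<in>?V. ia_group v = g \<and> pt z v \<noteq> 0"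
        by (intro bexI[of _ "(s, i, 0)"]) (auto simp: pt_0 ia_group_def g)
    qed
    ultimately show "\<exists>p. nondegenerate ?V ia_group p \<and> (\<forall>e\<in>?E. ia_form N M H0 e p + s * ia_form N M H e p = 0)"
      using H0 by (intro exI[of _ "pt z"] conjI ballI) simp_all
  qed
  then show ?thesis using IA_solvableI[OF pos] by blast
qed

section \<open>Generic unsolvability\<close>

lemma mon_cong_point: "(\<And>v. v \<in> V \<Longrightarrow> p v = q v) \<Longrightarrow> mon V \<alpha> p = mon V \<alpha> q"
  by (simp add: mon_def)

text \<open>Fubini on one coordinate: for almost all values of the others the polynomial in that
  coordinate is nonzero, and its finitely many roots are null. Extensional exponents are determined
  by their values on \<open>I\<close>, so terms with distinct exponents cannot cancel
  identically.\<close>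

lemma AE_mon_sum_nonzero:
  fixes \<mu> :: "complex measure"
  assumes \<mu>: "prob_space \<mu>" "sets \<mu> = sets borel" "\<And>x. emeasure \<mu> {x} = 0"
    and "finite I" "finite A" "A \<subseteq> extensional I" "\<exists>\<alpha>\<in>A. c \<alpha> \<noteq> 0"
  shows "AE H in PiM I (\<lambda>_. \<mu>). (\<Sum>\<alpha>\<in>A. c \<alpha> * mon I \<alpha> H) \<noteq> 0"
  using assms(4-)
proof (induction I arbitrary: A c rule: finite_induct)
  case empty
  then obtain \<alpha> where "\<alpha> \<in> A" "c \<alpha> \<noteq> 0" by blast
  moreover have "\<beta> = (\<lambda>_. undefined)" if "\<beta> \<in> A" for \<beta>
    using that empty.prems(2) by (auto simp: extensional_def)
  ultimately have "A = {\<alpha>}" "c \<alpha> \<noteq> 0" by auto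
  then show ?case by (simp add: mon_def)
next
  case (insert i I)
  interpret \<mu>: prob_space \<mu> by fact
  interpret PI: prob_space "PiM I (\<lambda>_. \<mu>)" by (intro prob_space_PiM \<mu>)
  interpret pair_sigma_finite \<mu> "PiM I (\<lambda>_. \<mu>)" ..
  let ?P = "\<lambda>H. \<Sum>\<alpha>\<in>A. c \<alpha> * mon (insert i I) \<alpha> H"
  have [measurable_cong]: "sets \<mu> = sets borel" by fact
  have meas: "?P \<in> borel_measurable (PiM (insert i I) (\<lambda>_. \<mu>))"
    unfolding mon_def by measurable
  obtain \<alpha>0 where \<alpha>0: "\<alpha>0 \<in> A" "c \<alpha>0 \<noteq> 0" using insert.prems by blast
  \<comment> \<open>The terms with \<open>\<alpha> i = k\<close> make up the coefficient of the
    \<open>k\<close>-th power of coordinate \<open>i\<close>; this choice of \<open>k\<close> gives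
    that coefficient a nonzero term.\<close>
  define k where "k = \<alpha>0 i"
  define A' where "A' = {\<alpha>\<in>A. \<alpha> i = k}"
  have inj: "inj_on (\<lambda>\<alpha>. restrict \<alpha> I) A'"
  proof (rule inj_onI)
    fix \<alpha> \<beta> assume *: "\<alpha> \<in> A'" "\<beta> \<in> A'" "restrict \<alpha> I = restrict \<beta> I"
    show "\<alpha> = \<beta>"
    proof
      fix v
      have "\<alpha> \<in> extensional (insert i I)" "\<beta> \<in> extensional (insert i I)" "\<alpha> i = \<beta> i"
        using * insert.prems by (auto simp: A'_def)
      then show "\<alpha> v = \<beta> v"
        using fun_cong[OF *(3), of v] by (cases "v \<in> insert i I") (auto simp: extensional_def)
    qed
  qed
  define c' where "c' = (\<lambda>\<beta>. c (inv_into A' (\<lambda>\<alpha>. restrict \<alpha> I) \<beta>))"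
  have "AE x in PiM I (\<lambda>_. \<mu>). (\<Sum>\<beta>\<in>(\<lambda>\<alpha>. restrict \<alpha> I) ` A'. c' \<beta> * mon I \<beta> x) \<noteq> 0"
  proof (rule insert.IH)
    show "finite ((\<lambda>\<alpha>. restrict \<alpha> I) ` A')" using insert.prems by (simp add: A'_def)
    show "(\<lambda>\<alpha>. restrict \<alpha> I) ` A' \<subseteq> extensional I" by auto
    have "\<alpha>0 \<in> A'" using \<alpha>0 by (simp add: A'_def k_def)
    moreover from this have "c' (restrict \<alpha>0 I) \<noteq> 0"
      using \<alpha>0 inv_into_f_f[OF inj] by (simp add: c'_def)
    ultimately show "\<exists>\<beta>\<in>(\<lambda>\<alpha>. restrict \<alpha> I) ` A'. c' \<beta> \<noteq> 0" by blast
  qed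
  moreover have "(\<Sum>\<beta>\<in>(\<lambda>\<alpha>. restrict \<alpha> I) ` A'. c' \<beta> * mon I \<beta> x) = (\<Sum>\<alpha>\<in>A'. c \<alpha> * mon I \<alpha> x)" for x
    by (subst sum.reindex[OF inj]) (auto intro!: sum.cong simp: c'_def mon_restrict inv_into_f_f[OF inj])
  ultimately have "AE x in PiM I (\<lambda>_. \<mu>). (\<Sum>\<alpha>\<in>A'. c \<alpha> * mon I \<alpha> x) \<noteq> 0" by simp
  then have "AE x in PiM I (\<lambda>_. \<mu>). AE y in \<mu>. ?P (x(i := y)) \<noteq> 0"
  proof (rule eventually_mono)
    fix x assume x: "(\<Sum>\<alpha>\<in>A'. c \<alpha> * mon I \<alpha> x) \<noteq> 0"
    define r where "r = (\<Sum>\<alpha>\<in>A. monom (c \<alpha> * mon I \<alpha> x) (\<alpha> i))"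
    have "coeff r k = (\<Sum>\<alpha>\<in>A. if \<alpha> i = k then c \<alpha> * mon I \<alpha> x else 0)"
      by (simp add: r_def coeff_sum)
    also have "\<dots> = (\<Sum>\<alpha>\<in>A'. c \<alpha> * mon I \<alpha> x)"
      unfolding A'_def using insert.prems by (simp add: sum.inter_filter)
    finally have "r \<noteq> 0" using x by auto
    then have fin: "finite {y. poly r y = 0}" by (rule poly_roots_finite)
    have "?P (x(i := y)) = poly r y" for y
    proof -
      have "mon (insert i I) \<alpha> (x(i := y)) = y ^ \<alpha> i * mon I \<alpha> x" for \<alpha>
      proof -
        have "mon I \<alpha> (x(i := y)) = mon I \<alpha> x"
          using insert.hyps by (intro mon_cong_point) auto
        then show ?thesis using insert.hyps by (simp add: mon_def)
      qed
      then show ?thesis by (simp add: r_def poly_sum poly_monom mult_ac)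
    qed
    moreover have "AE y in \<mu>. poly r y \<noteq> 0"
    proof (rule AE_I')
      have "{y} \<in> null_sets \<mu>" for y using \<mu> by (intro null_setsI) auto
      then have "(\<Union>y\<in>{y. poly r y = 0}. {y}) \<in> null_sets \<mu>"
        using countable_finite[OF fin] by (rule null_sets_UN'[rotated])
      then show "{y. poly r y = 0} \<in> null_sets \<mu>" by simp
    qed auto
    ultimately show "AE y in \<mu>. ?P (x(i := y)) \<noteq> 0" by simp
  qed
  \<comment> \<open>The new coordinate \<open>y\<close> is the inner variable so far, but the
    decomposition of the product measure puts it first; measurability licenses the
    interchange.\<close>
  moreover have mset: "{z \<in> space (\<mu> \<Otimes>\<^sub>M PiM I (\<lambda>_. \<mu>)). ?P ((snd z)(i := fst z)) \<noteq> 0}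
      \<in> sets (\<mu> \<Otimes>\<^sub>M PiM I (\<lambda>_. \<mu>))"
  proof -
    have "(\<lambda>z. (snd z)(i := fst z)) \<in> measurable (\<mu> \<Otimes>\<^sub>M PiM I (\<lambda>_. \<mu>)) (PiM (insert i I) (\<lambda>_. \<mu>))"
      by measurable
    from measurable_compose[OF this meas] show ?thesis by measurable
  qed
  ultimately have "AE y in \<mu>. AE x in PiM I (\<lambda>_. \<mu>). ?P (x(i := y)) \<noteq> 0"
    using AE_commute[of "\<lambda>y x. ?P (x(i := y)) \<noteq> 0", OF mset] by blast
  then have "AE z in \<mu> \<Otimes>\<^sub>M PiM I (\<lambda>_. \<mu>). ?P ((snd z)(i := fst z)) \<noteq> 0"
    using AE_pair_iff[of "\<lambda>y x. ?P (x(i := y)) \<noteq> 0", OF mset] by blast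
  then have "AE z in \<mu> \<Otimes>\<^sub>M PiM I (\<lambda>_. \<mu>). ?P ((\<lambda>(x, X). X(i := x)) z) \<noteq> 0"
    by (simp add: case_prod_unfold)
  then have "AE H in distr (\<mu> \<Otimes>\<^sub>M PiM I (\<lambda>_. \<mu>)) (PiM (insert i I) (\<lambda>_. \<mu>)) (\<lambda>(x, X). X(i := x)). ?P H \<noteq> 0"
    by (subst AE_distr_iff) (use meas in measurable)
  then show ?case
    unfolding distr_pair_PiM_eq_PiM[where M = "\<lambda>_. \<mu>" and I = I and i' = i, OF \<mu>(1) \<mu>(1)] .
qed

section \<open>Algebraic dependence by counting monomials\<close>

definition polys_bdd :: "'v set \<Rightarrow> nat \<Rightarrow> (('v \<Rightarrow> complex) \<Rightarrow> complex) set" where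
  "polys_bdd U n = fs.span (mon U ` {\<alpha>. \<forall>u\<in>U. \<alpha> u \<le> n})"

lemma polys_bdd_mono: "m \<le> n \<Longrightarrow> polys_bdd U m \<subseteq> polys_bdd U n"
  unfolding polys_bdd_def by (intro fs.span_mono) (auto intro: order_trans)

lemma polys_bdd_mult:
  assumes "f \<in> polys_bdd U m" "g \<in> polys_bdd U n"
  shows "f * g \<in> polys_bdd U (m + n)"
  using assms unfolding polys_bdd_def
proof (rule span_mult)
  fix a b assume "a \<in> mon U ` {\<alpha>. \<forall>u\<in>U. \<alpha> u \<le> m}" "b \<in> mon U ` {\<alpha>. \<forall>u\<in>U. \<alpha> u \<le> n}"
  then obtain \<alpha> \<beta> where *: "a = mon U \<alpha>" "b = mon U \<beta>" "\<forall>u\<in>U. \<alpha> u \<le> m" "\<forall>u\<in>U. \<beta> u \<le> n" by auto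
  then have "a * b = mon U (\<alpha> + \<beta>)" by (simp only: mon_mult)
  moreover have "\<forall>u\<in>U. (\<alpha> + \<beta>) u \<le> m + n" using * by (auto intro: add_mono)
  ultimately show "a * b \<in> fs.span (mon U ` {\<alpha>. \<forall>u\<in>U. \<alpha> u \<le> m + n})"
    by (intro fs.span_base) blast
qed

lemma one_in_polys_bdd: "1 \<in> polys_bdd U n"
proof -
  have "mon U (\<lambda>_. 0) \<in> polys_bdd U n" unfolding polys_bdd_def by (rule fs.span_base) auto
  then show ?thesis by (simp only: mon_0)
qed

lemma coord_in_polys_bdd:
  assumes "finite U" "u \<in> U"
  shows "(\<lambda>q. q u) \<in> polys_bdd U 1"
  unfolding coord_eq_mon[OF assms] polys_bdd_def by (rule fs.span_base) auto

lemma polys_bdd_power: "f \<in> polys_bdd U n \<Longrightarrow> f ^ k \<in> polys_bdd U (k * n)"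
proof (induction k)
  case 0
  show ?case unfolding power_0 by (rule one_in_polys_bdd)
next
  case (Suc k)
  then show ?case unfolding power_Suc mult_Suc by (intro polys_bdd_mult)
qed

lemma polys_bdd_prod:
  assumes "finite I" "\<And>e. e \<in> I \<Longrightarrow> f e \<in> polys_bdd U n"
  shows "(\<Prod>e\<in>I. f e) \<in> polys_bdd U (card I * n)"
  using assms
proof (induction I rule: finite_induct)
  case empty
  show ?case unfolding prod.empty by (rule one_in_polys_bdd)
next
  case (insert e I)
  then have "f e * (\<Prod>e\<in>I. f e) \<in> polys_bdd U (n + card I * n)" by (intro polys_bdd_mult) auto
  then show ?case
    unfolding prod.insert[OF insert.hyps] card_insert_disjoint[OF insert.hyps] mult_Suc .
qed

lemma prod_fun_apply: "(\<Prod>i\<in>I. f i) x = (\<Prod>i\<in>I. f i x :: complex)"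
  by (induction I rule: infinite_finite_induct) auto

text \<open>Bounding the degree in each variable separately makes the exponents a box with
  \<open>(n + 1) ^ card U\<close> elements.\<close>

lemma polys_bdd_coeffs:
  assumes "finite U" "f \<in> polys_bdd U n"
  shows "\<exists>a. \<forall>q. f q = (\<Sum>\<beta>\<in>PiE U (\<lambda>_. {..n}). a \<beta> * mon U \<beta> q)"
proof -
  obtain T c where T: "T \<subseteq> (\<lambda>\<alpha>. restrict \<alpha> U) ` {\<alpha>. \<forall>u\<in>U. \<alpha> u \<le> n}"
    and f: "f = (\<lambda>p. \<Sum>\<alpha>\<in>T. c \<alpha> * mon U \<alpha> p)"
    using span_mon_finite_support assms(2) unfolding polys_bdd_def by blast
  have sub: "T \<subseteq> PiE U (\<lambda>_. {..n})" using T by auto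
  have "f q = (\<Sum>\<beta>\<in>PiE U (\<lambda>_. {..n}). (if \<beta> \<in> T then c \<beta> else 0) * mon U \<beta> q)" for q
    unfolding f using sub assms(1) by (intro sum.mono_neutral_cong_left finite_PiE) auto
  then show ?thesis by (intro exI[of _ "\<lambda>\<beta>. if \<beta> \<in> T then c \<beta> else 0"] allI)
qed

text \<open>There are \<open>D ^ card I\<close> monomials of degree less than \<open>D\<close> in each of the functions \<open>\<phi> e\<close>, and they
  lie in a space whose dimension grows like \<open>D ^ card U\<close>.\<close>

lemma algebraic_dependence:
  fixes \<phi> :: "'e \<Rightarrow> ('u \<Rightarrow> complex) \<Rightarrow> complex"
  assumes U: "finite U" and I: "finite I" and less: "card U < card I"
    and \<phi>: "\<And>e. e \<in> I \<Longrightarrow> \<phi> e \<in> polys_bdd U n"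
  shows "\<exists>A c. finite A \<and> A \<subseteq> extensional I \<and> (\<exists>\<alpha>\<in>A. c \<alpha> \<noteq> 0) \<and>
    (\<forall>q. (\<Sum>\<alpha>\<in>A. c \<alpha> * mon I \<alpha> (\<lambda>e. \<phi> e q)) = 0)"
proof -
  \<comment> \<open>The constants satisfy \<open>d + 1 \<le> m * D\<close> and
    \<open>m ^ card U < D\<close>, so \<open>(d + 1) ^ card U\<close> stays below
    \<open>D ^ (card U + 1)\<close> and hence below \<open>D ^ card I\<close>.\<close>
  define m where "m = card I * n + 1"
  define D where "D = m ^ card U + 1"
  define d where "d = card I * (D * n)"
  define A where "A = PiE I (\<lambda>_. {..<D})"
  define B where "B = PiE U (\<lambda>_. {..d})"
  have fin: "finite A" "finite B" using I U by (auto simp: A_def B_def intro: finite_PiE)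
  have "card B = (d + 1) ^ card U" using U by (simp add: B_def card_PiE)
  also have "\<dots> \<le> (m * D) ^ card U"
    by (intro power_mono) (auto simp: m_def d_def D_def algebra_simps)
  also have "\<dots> < D * D ^ card U"
    unfolding power_mult_distrib by (intro mult_strict_right_mono) (auto simp: D_def)
  also have "\<dots> = D ^ Suc (card U)" by simp
  also have "\<dots> \<le> D ^ card I" using less by (intro power_increasing) (auto simp: D_def)
  also have "\<dots> = card A" using I by (simp add: A_def card_PiE)
  finally have card: "card B < card A" .
  have "\<exists>a. \<forall>q. mon I \<alpha> (\<lambda>e. \<phi> e q) = (\<Sum>\<beta>\<in>B. a \<beta> * mon U \<beta> q)" if \<alpha>: "\<alpha> \<in> A" for \<alpha>
  proof -
    have "\<phi> e ^ \<alpha> e \<in> polys_bdd U (D * n)" if e: "e \<in> I" for e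
    proof -
      have "\<alpha> e \<le> D" using \<alpha> e by (force simp: A_def)
      then show ?thesis
        using polys_bdd_power[OF \<phi>[OF e], of "\<alpha> e"] polys_bdd_mono[of "\<alpha> e * n" "D * n" U] by auto
    qed
    then have "(\<Prod>e\<in>I. \<phi> e ^ \<alpha> e) \<in> polys_bdd U d"
      unfolding d_def by (rule polys_bdd_prod[OF I])
    from polys_bdd_coeffs[OF U this] show ?thesis
      unfolding prod_fun_apply power_fun_apply mon_def B_def .
  qed
  then have "\<forall>\<alpha>\<in>A. \<exists>a. \<forall>q. mon I \<alpha> (\<lambda>e. \<phi> e q) = (\<Sum>\<beta>\<in>B. a \<beta> * mon U \<beta> q)" by blast
  from bchoice[OF this] obtain a
    where a: "\<And>\<alpha> q. \<alpha> \<in> A \<Longrightarrow> mon I \<alpha> (\<lambda>e. \<phi> e q) = (\<Sum>\<beta>\<in>B. a \<alpha> \<beta> * mon U \<beta> q)" by blast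
  obtain c where c: "\<exists>\<alpha>\<in>A. c \<alpha> \<noteq> 0" "\<forall>\<beta>\<in>B. (\<Sum>\<alpha>\<in>A. c \<alpha> * a \<alpha> \<beta>) = 0"
    using linear_dependence[OF fin(2,1) card, of a] by blast
  have "(\<Sum>\<alpha>\<in>A. c \<alpha> * mon I \<alpha> (\<lambda>e. \<phi> e q)) = 0" for q
  proof -
    have "(\<Sum>\<alpha>\<in>A. c \<alpha> * mon I \<alpha> (\<lambda>e. \<phi> e q)) = (\<Sum>\<alpha>\<in>A. \<Sum>\<beta>\<in>B. c \<alpha> * a \<alpha> \<beta> * mon U \<beta> q)"
      by (intro sum.cong refl) (simp add: a sum_distrib_left mult.assoc)
    also have "\<dots> = (\<Sum>\<beta>\<in>B. (\<Sum>\<alpha>\<in>A. c \<alpha> * a \<alpha> \<beta>) * mon U \<beta> q)"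
      by (subst sum.swap) (simp add: sum_distrib_right)
    also have "\<dots> = 0" using c(2) by simp
    finally show ?thesis .
  qed
  then show ?thesis using fin(1) c(1)
    by (intro exI[of _ A] exI[of _ c]) (auto simp: A_def PiE_def)
qed

section \<open>Parametrising the solvable channels\<close>

lemma finite_channel_entries: "finite (channel_entries K N M)"
proof -
  have "channel_entries K N M \<subseteq> (\<Union>i\<in>{1..K}. \<Union>j\<in>{1..K}. {i} \<times> {j} \<times> {..<N i} \<times> {..<M j})"
    by (auto simp: channel_entries_def)
  then show ?thesis by (rule finite_subset) auto
qed

text \<open>With \<open>g i (a i) = 1\<close> and \<open>t j (b j) = 1\<close>, the equation of the link \<open>(i, j)\<close> expresses the entry
  \<open>(a i, b j)\<close> of its channel matrix through the remaining unknowns.\<close>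

lemma solvable_chart_hypersurface:
  assumes sub: "SR \<subseteq> {1..K}" "ST \<subseteq> {1..K}"
    and less: "N_Var N M SR ST < N_Eq SR ST"
    and a: "\<And>i. i \<in> SR \<Longrightarrow> a i < N i" and b: "\<And>j. j \<in> ST \<Longrightarrow> b j < M j"
  shows "\<exists>A c. finite A \<and> A \<subseteq> extensional (channel_entries K N M) \<and> (\<exists>\<alpha>\<in>A. c \<alpha> \<noteq> 0) \<and>
    (\<forall>H g t. (\<forall>i\<in>SR. g i (a i) \<noteq> 0) \<longrightarrow> (\<forall>j\<in>ST. t j (b j) \<noteq> 0) \<longrightarrow>
      (\<forall>i\<in>SR. \<forall>j\<in>ST. i \<noteq> j \<longrightarrow> (\<Sum>x<N i. \<Sum>y<M j. cnj (g i x) * H (i, j, x, y) * t j y) = 0) \<longrightarrow>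
      (\<Sum>\<alpha>\<in>A. c \<alpha> * mon (channel_entries K N M) \<alpha> H) = 0)"
proof -
  let ?I = "channel_entries K N M"
  define piv where "piv = (\<lambda>(i, j). (i, j, a i, b j)) ` {(i, j). i \<in> SR \<and> j \<in> ST \<and> i \<noteq> j}"
  define vars where "vars = Pair False ` Sigma SR (\<lambda>i. {..<N i} - {a i}) \<union>
     Pair True ` Sigma ST (\<lambda>j. {..<M j} - {b j})"
  define U where "U = (Inl ` vars \<union> Inr ` (?I - piv) :: ((bool \<times> nat \<times> nat) + (nat \<times> nat \<times> nat \<times> nat)) set)"
  have finS: "finite SR" "finite ST" using sub finite_subset by auto
  have pivI: "piv \<subseteq> ?I" using sub a b by (auto simp: piv_def channel_entries_def)
  have fpiv: "finite piv" using pivI finite_channel_entries finite_subset by blast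
  have cpiv: "card piv = N_Eq SR ST"
    unfolding piv_def N_Eq_def by (rule card_image) (auto simp: inj_on_def)
  have cvars: "card vars = N_Var N M SR ST"
    unfolding vars_def using finS a b
    by (subst card_Un_disjoint) (auto simp: card_image inj_on_def N_Var_def)
  have fvars: "finite vars" unfolding vars_def using finS by auto
  have U: "finite U" using fvars finite_channel_entries by (auto simp: U_def)
  \<comment> \<open>Solving for the pivots saves \<open>N_Eq SR ST\<close> parameters, while the
    normalised vectors add only \<open>N_Var N M SR ST\<close>.\<close>
  have "card U = card vars + card (?I - piv)"
    unfolding U_def using fvars finite_channel_entries
    by (subst card_Un_disjoint) (auto simp: card_image)
  also have "card (?I - piv) = card ?I - card piv" using fpiv pivI by (rule card_Diff_subset)
  finally have cU: "card U < card ?I"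
    using less cvars cpiv card_mono[OF finite_channel_entries pivI] by simp
  define G where "G = (\<lambda>(q :: (bool \<times> nat \<times> nat) + (nat \<times> nat \<times> nat \<times> nat) \<Rightarrow> complex) i x.
     if x = a i then 1 else q (Inl (False, i, x)))"
  define T where "T = (\<lambda>(q :: (bool \<times> nat \<times> nat) + (nat \<times> nat \<times> nat \<times> nat) \<Rightarrow> complex) j y.
     if y = b j then 1 else q (Inl (True, j, y)))"
  \<comment> \<open>Each term of a pivot entry has three factors of degree at most 1 in every
    parameter, whence the bound 3 below.\<close>
  define \<phi> where "\<phi> = (\<lambda>e q. if e \<in> piv then (case e of (i, j, _, _) \<Rightarrow>
      - (\<Sum>(x, y)\<in>{..<N i} \<times> {..<M j} - {(a i, b j)}. G q i x * q (Inr (i, j, x, y)) * T q j y))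
      else q (Inr e))"
  have \<phi>: "\<phi> e \<in> polys_bdd U 3" if e: "e \<in> ?I" for e
  proof (cases "e \<in> piv")
    case False
    then have "\<phi> e = (\<lambda>q. q (Inr e))" by (simp add: \<phi>_def)
    moreover have "(\<lambda>q. q (Inr e)) \<in> polys_bdd U 1"
      using False e by (intro coord_in_polys_bdd U) (auto simp: U_def)
    ultimately show ?thesis using polys_bdd_mono[of 1 3 U] by auto
  next
    case True
    then obtain i j where ij: "e = (i, j, a i, b j)" "i \<in> SR" "j \<in> ST" "i \<noteq> j" by (auto simp: piv_def)
    let ?X = "{..<N i} \<times> {..<M j} - {(a i, b j)}"
    have "\<phi> e = - (\<Sum>(x, y)\<in>?X. (\<lambda>q. G q i x) * (\<lambda>q. q (Inr (i, j, x, y))) * (\<lambda>q. T q j y))"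
      using True by (auto simp: \<phi>_def ij fun_eq_iff sum_fun_apply case_prod_unfold)
    also have "\<dots> \<in> polys_bdd U 3"
    proof -
      have "(\<lambda>q. G q i x) * (\<lambda>q. q (Inr (i, j, x, y))) * (\<lambda>q. T q j y) \<in> polys_bdd U (1 + 1 + 1)"
        if xy: "(x, y) \<in> ?X" for x y
      proof (intro polys_bdd_mult)
        show "(\<lambda>q. G q i x) \<in> polys_bdd U 1"
        proof (cases "x = a i")
          case True
          then show ?thesis using one_in_polys_bdd[of U 1] by (simp add: G_def one_fun_def)
        next
          case False
          then show ?thesis
            using xy ij coord_in_polys_bdd[OF U, of "Inl (False, i, x)"] by (simp add: G_def U_def vars_def)
        qed
        show "(\<lambda>q. T q j y) \<in> polys_bdd U 1"
        proof (cases "y = b j")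
          case True
          then show ?thesis using one_in_polys_bdd[of U 1] by (simp add: T_def one_fun_def)
        next
          case False
          then show ?thesis
            using xy ij coord_in_polys_bdd[OF U, of "Inl (True, j, y)"] by (simp add: T_def U_def vars_def)
        qed
        have "(i, j, x, y) \<notin> piv" "(i, j, x, y) \<in> ?I"
          using xy ij sub by (auto simp: piv_def channel_entries_def)
        then show "(\<lambda>q. q (Inr (i, j, x, y))) \<in> polys_bdd U 1"
          by (intro coord_in_polys_bdd U) (auto simp: U_def)
      qed
      then show ?thesis unfolding polys_bdd_def
        by (intro fs.span_neg fs.span_sum) (auto simp: numeral_3_eq_3 split: prod.splits)
    qed
    finally show ?thesis .
  qed
  have "\<exists>A c. finite A \<and> A \<subseteq> extensional ?I \<and> (\<exists>\<alpha>\<in>A. c \<alpha> \<noteq> 0) \<and>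
      (\<forall>q. (\<Sum>\<alpha>\<in>A. c \<alpha> * mon ?I \<alpha> (\<lambda>e. \<phi> e q)) = 0)"
    by (rule algebraic_dependence[OF U finite_channel_entries cU \<phi>])
  then obtain A c
    where A: "finite A" "A \<subseteq> extensional ?I" "\<exists>\<alpha>\<in>A. c \<alpha> \<noteq> 0"
      and van: "\<forall>q. (\<Sum>\<alpha>\<in>A. c \<alpha> * mon ?I \<alpha> (\<lambda>e. \<phi> e q)) = 0"
    by (elim exE conjE) (rule that; assumption)
  have van_H: "(\<Sum>\<alpha>\<in>A. c \<alpha> * mon ?I \<alpha> H) = 0"
    if g: "\<forall>i\<in>SR. g i (a i) \<noteq> 0" and t: "\<forall>j\<in>ST. t j (b j) \<noteq> 0"
      and eq: "\<forall>i\<in>SR. \<forall>j\<in>ST. i \<noteq> j \<longrightarrow> (\<Sum>x<N i. \<Sum>y<M j. cnj (g i x) * H (i, j, x, y) * t j y) = 0"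
    for H g t
  proof -
    \<comment> \<open>Dividing each vector by its chosen entry preserves the equations, so a
      solution for \<open>H\<close> provides parameters at which \<open>\<phi>\<close> takes the
      value \<open>H\<close>.\<close>
    define q where "q = case_sum
      (\<lambda>(s, i, x). if s then t i x / t i (b i) else cnj (g i x) / cnj (g i (a i))) H"
    have "\<phi> e q = H e" for e
    proof (cases "e \<in> piv")
      case False
      then show ?thesis by (simp add: \<phi>_def q_def)
    next
      case True
      then obtain i j where ij: "e = (i, j, a i, b j)" "i \<in> SR" "j \<in> ST" "i \<noteq> j" by (auto simp: piv_def)
      have Gq: "G q i x = cnj (g i x) / cnj (g i (a i))" for x using g ij by (simp add: G_def q_def)
      have Tq: "T q j y = t j y / t j (b j)" for y using t ij by (simp add: T_def q_def)
      have Hq: "q (Inr e') = H e'" for e' by (simp add: q_def)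
      let ?s = "\<lambda>(x, y). G q i x * q (Inr (i, j, x, y)) * T q j y"
      have "(\<Sum>z\<in>{..<N i} \<times> {..<M j}. ?s z) =
         (\<Sum>x<N i. \<Sum>y<M j. cnj (g i x) * H (i, j, x, y) * t j y) / (cnj (g i (a i)) * t j (b j))"
        by (simp add: sum.cartesian_product[symmetric] sum_divide_distrib Gq Tq Hq)
      also have "\<dots> = 0" using eq ij by simp
      finally have "(\<Sum>z\<in>{..<N i} \<times> {..<M j}. ?s z) = 0" .
      moreover have "(\<Sum>z\<in>{..<N i} \<times> {..<M j}. ?s z) = ?s (a i, b j) + (\<Sum>z\<in>{..<N i} \<times> {..<M j} - {(a i, b j)}. ?s z)"
        using a b ij by (intro sum.remove) auto
      moreover have "?s (a i, b j) = H e" by (simp add: ij G_def T_def q_def)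
      ultimately have "H e = - (\<Sum>z\<in>{..<N i} \<times> {..<M j} - {(a i, b j)}. ?s z)"
        by (simp add: eq_neg_iff_add_eq_0)
      then show ?thesis using True by (simp add: \<phi>_def ij)
    qed
    then have "(\<lambda>e. \<phi> e q) = H" by blast
    with spec[OF van, of q] show ?thesis by (simp only:)
  qed
  show ?thesis
    by (intro exI[of _ A] exI[of _ c] conjI A allI impI) (rule van_H)
qed

text \<open>Finitely many charts cover the solvable channels, since each vector has a nonzero entry.
  Each chart is contained in a null hypersurface, so measurability of the solvable set itself is not
  at issue.\<close>

lemma AE_not_IA_solvable:
  assumes \<mu>: "prob_space \<mu>" "sets \<mu> = sets borel" "\<And>x. emeasure \<mu> {x} = 0"
    and sub: "SR \<subseteq> {1..K}" "ST \<subseteq> {1..K}" and less: "N_Var N M SR ST < N_Eq SR ST"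
  shows "AE H in PiM (channel_entries K N M) (\<lambda>_. \<mu>). \<not> IA_solvable K N M H"
proof -
  let ?I = "channel_entries K N M"
  define Ch where "Ch = PiE SR (\<lambda>i. {..<N i}) \<times> PiE ST (\<lambda>j. {..<M j})"
  \<comment> \<open>Only the equations between \<open>SR\<close> and \<open>ST\<close> are kept, the
    subsystem whose count is violated.\<close>
  define chart where "chart = (\<lambda>ab H. \<exists>g t. (\<forall>i\<in>SR. g i (fst ab i) \<noteq> 0) \<and> (\<forall>j\<in>ST. t j (snd ab j) \<noteq> 0) \<and>
      (\<forall>i\<in>SR. \<forall>j\<in>ST. i \<noteq> j \<longrightarrow> (\<Sum>x<N i. \<Sum>y<M j. cnj (g i x) * H (i, j, x, y) * t j y) = 0))"
  have "finite SR" "finite ST" using sub finite_subset by auto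
  then have "finite Ch" unfolding Ch_def by (intro finite_cartesian_product finite_PiE) auto
  moreover have "AE H in PiM ?I (\<lambda>_. \<mu>). \<not> chart ab H" if "ab \<in> Ch" for ab
  proof -
    have "fst ab i < N i" if "i \<in> SR" for i using \<open>ab \<in> Ch\<close> that by (auto simp: Ch_def)
    moreover have "snd ab j < M j" if "j \<in> ST" for j using \<open>ab \<in> Ch\<close> that by (auto simp: Ch_def)
    ultimately obtain A c
      where A: "finite A" "A \<subseteq> extensional ?I" "\<exists>\<alpha>\<in>A. c \<alpha> \<noteq> 0"
        and van: "\<forall>H g t. (\<forall>i\<in>SR. g i (fst ab i) \<noteq> 0) \<longrightarrow> (\<forall>j\<in>ST. t j (snd ab j) \<noteq> 0) \<longrightarrow>
          (\<forall>i\<in>SR. \<forall>j\<in>ST. i \<noteq> j \<longrightarrow> (\<Sum>x<N i. \<Sum>y<M j. cnj (g i x) * H (i, j, x, y) * t j y) = 0) \<longrightarrow>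
          (\<Sum>\<alpha>\<in>A. c \<alpha> * mon ?I \<alpha> H) = 0"
      by (rule exE[OF solvable_chart_hypersurface[OF sub less, of "fst ab" "snd ab"]])
        (assumption | elim exE conjE | rule that)+
    have "(\<Sum>\<alpha>\<in>A. c \<alpha> * mon ?I \<alpha> H) = 0" if "chart ab H" for H
      using that unfolding chart_def
      by (elim exE conjE) (rule van[THEN spec, THEN spec, THEN spec, THEN mp, THEN mp, THEN mp])
    note van = this
    from AE_mon_sum_nonzero[OF \<mu> finite_channel_entries A] show ?thesis
      by (rule AE_mp) (use van in \<open>auto intro!: AE_I2\<close>)
  qed
  ultimately have "AE H in PiM ?I (\<lambda>_. \<mu>). \<forall>ab\<in>Ch. \<not> chart ab H"
    by (simp add: AE_finite_all)
  then show ?thesis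
  proof (rule AE_mp, intro AE_I2 impI notI)
    fix H assume no: "\<forall>ab\<in>Ch. \<not> chart ab H" and "IA_solvable K N M H"
    then obtain t g where t: "\<forall>j\<in>{1..K}. \<exists>b. b < M j \<and> t j b \<noteq> 0" and g: "\<forall>i\<in>{1..K}. \<exists>a. a < N i \<and> g i a \<noteq> 0"
      and eq: "\<forall>i\<in>{1..K}. \<forall>j\<in>{1..K}. i \<noteq> j \<longrightarrow>
         (\<Sum>a<N i. \<Sum>b<M j. cnj (g i a) * H (i, j, a, b) * t j b) = 0"
      unfolding IA_solvable_def by blast
    from bchoice[OF g] obtain a where a: "\<forall>i\<in>{1..K}. a i < N i \<and> g i (a i) \<noteq> 0" by blast
    from bchoice[OF t] obtain b where b: "\<forall>j\<in>{1..K}. b j < M j \<and> t j (b j) \<noteq> 0" by blast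
    have "(restrict a SR, restrict b ST) \<in> Ch" using a b sub by (auto simp: Ch_def)
    moreover have "chart (restrict a SR, restrict b ST) H"
      unfolding chart_def
    proof (rule exI[of _ g], rule exI[of _ t], intro conjI ballI impI)
      fix i j assume "i \<in> SR" "j \<in> ST" "i \<noteq> j"
      then show "(\<Sum>x<N i. \<Sum>y<M j. cnj (g i x) * H (i, j, x, y) * t j y) = 0"
        using eq[THEN bspec, THEN bspec, THEN mp] sub by blast
    qed (use a b sub in auto)
    ultimately show False using no by blast
  qed
qed

theorem theorem2:
  fixes \<mu> :: "complex measure" and K :: nat and N M :: "nat \<Rightarrow> nat"
  assumes "prob_space \<mu>"
    and "sets \<mu> = sets borel"
    and "absolutely_continuous lborel \<mu>"
    and "K \<ge> 2"
    and "\<forall>i\<in>{1..K}. N i \<ge> 1 \<and> M i \<ge> 1"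
  shows "IA_feasible \<mu> K N M \<longleftrightarrow>
    (\<forall>SR ST. SR \<subseteq> {1..K} \<longrightarrow> ST \<subseteq> {1..K} \<longrightarrow> N_Var N M SR ST \<ge> N_Eq SR ST)"
proof
  assume feas: "IA_feasible \<mu> K N M"
  \<comment> \<open>Points are Lebesgue null, so absolute continuity makes \<open>\<mu>\<close>
    atomless; this is how continuity of the distribution enters.\<close>
  have "{x} \<in> null_sets lborel" for x :: complex by (auto intro!: null_setsI)
  then have atom: "emeasure \<mu> {x} = 0" for x
    using assms(3) unfolding absolutely_continuous_def by blast
  interpret PiM: prob_space "PiM (channel_entries K N M) (\<lambda>_. \<mu>)"
    by (intro prob_space_PiM assms(1))
  show "\<forall>SR ST. SR \<subseteq> {1..K} \<longrightarrow> ST \<subseteq> {1..K} \<longrightarrow> N_Var N M SR ST \<ge> N_Eq SR ST"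
  proof (intro allI impI, rule ccontr)
    fix SR ST assume "SR \<subseteq> {1..K}" "ST \<subseteq> {1..K}" "\<not> N_Eq SR ST \<le> N_Var N M SR ST"
    \<comment> \<open>A violated count makes the channel unsolvable with probability one, and two
      contradictory almost sure statements cannot coexist in a probability space.\<close>
    then have "AE H in PiM (channel_entries K N M) (\<lambda>_. \<mu>). \<not> IA_solvable K N M H"
      by (intro AE_not_IA_solvable[where SR = SR and ST = ST] assms(1,2) atom) auto
    with feas have "AE H in PiM (channel_entries K N M) (\<lambda>_. \<mu>). False"
      unfolding IA_feasible_def by eventually_elim simp
    then show False by simp
  qed
next
  assume "\<forall>SR ST. SR \<subseteq> {1..K} \<longrightarrow> ST \<subseteq> {1..K} \<longrightarrow> N_Var N M SR ST \<ge> N_Eq SR ST"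
  from exists_matching[OF this] have "IA_solvable K N M H" for H
    using IA_solvable_if_matching[OF assms(5)] by blast
  then show "IA_feasible \<mu> K N M" by (simp add: IA_feasible_def)
qed

end
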